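(* Let $\hat{\mathcal K}$ be the vector space spanned by the leading terms $\{\hat{\mathfrak k} \mid \mathfrak k\in\mathcal K,\ \mathfrak k\neq 0\}$. Then $\hat{\mathcal K}$ is a Lie subalgebra of $\mathcal H$ and $\dim(\hat{\mathcal K})=\dim(\mathcal K)$. Moreover, $\hat{\mathcal K}\subseteq \mathcal H_{\overline{y_e}}$, where $\mathcal H_{\overline{y_e}}$ is the stabilizer in $\mathcal H$ of the image $\overline{y_e}$ of $y_e$ in $\overline N=V/T_zO(z)$.
   Context: Let $X$ be a complex vector space of dimension $n$ and $G\subseteq GL(X)$ a reductive algebraic group over $\mathbb C$ containing the center $\{tI \mid t\in\mathbb C^*\}$ of $GL(X)$. Let $\rho:G\to GL(V)$ be a finite dimensional rational representation in which the center acts by a fixed non-trivial character: $tI\cdot v=t^c v$ for all $v\in V$, for some integer $c\neq 0$. Let $\mathcal G=Lie(G)$, acting on $V$ through the differential of $\rho$; write $gv$ and $\mathfrak g v$ for the actions. Let $\lambda:\mathbb C^*\to G$ be a one-parameter subgroup. It gives gradings $V=\oplus_i V_i$ with $\lambda(t)v_i=t^iv_i$ for $v_i\in V_i$, and $\mathcal G=\oplus_j\mathcal G_j$ with $\lambda(t)\mathfrak g_j\lambda(t)^{-1}=t^j\mathfrak g_j$ for $\mathfrak g_j\in\mathcal G_j$. For a nonzero $v=\sum_i v_i$ (resp. $\mathfrak g=\sum_j\mathfrak g_j$), the leading term $\hat v$ (resp. $\hat{\mathfrak g}$) is the nonzero homogeneous component of smallest degree. Let $y\in V$ be such that $\lambda(t)y=t^dz+t^ey_e+\cdots+t^Dy_D$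 with $d<e<\cdots<D$ and $z,y_e$ nonzero (so $z=\hat y$; $y_e$ is the next nonzero component, the "tangent of approach"). Let $\mathcal K=\{\mathfrak g\in\mathcal G\mid\mathfrak gy=0\}$ and $\mathcal H=\{\mathfrak g\in\mathcal G\mid\mathfrak gz=0\}$. Let $O(z)=Gz$, with tangent space $T_zO(z)=\mathcal G\cdot z$ at $z$. The space $\overline N=V/T_zO(z)$ is an $\mathcal H$-module by the quotient action, and $\mathcal H_{\overline{y_e}}=\{\mathfrak h\in\mathcal H\mid \mathfrak h y_e\in T_zO(z)\}$. *)

theory Defs
  imports
    "HOL-Analysis.Analysis"
    "HOL-Algebra.Coset"
    "HOL-Computational_Algebra.Polynomial"
begin

text \<open>
  The spaces \<open>X\<close> and \<open>V\<close> are \<open>complex^'n\<close> and \<open>complex^'m\<close>, so that \<open>GL(X)\<close>, \<open>GL(V)\<close> and their Lie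
  algebras consist of square matrices.
\<close>

definition GL :: "(complex^'n^'n) monoid" where
  "GL = \<lparr>carrier = {A. invertible A}, mult = (**), one = mat 1\<rparr>"

definition Gm :: "complex monoid" where
  "Gm = \<lparr>carrier = - {0}, mult = (*), one = 1\<rparr>"

text \<open>The scalar multiplication \<open>*s\<close> on \<open>complex^'n^'n\<close> would take its scalars in \<open>complex^'n\<close>.\<close>

definition mscale :: "complex \<Rightarrow> complex^'n^'n \<Rightarrow> complex^'n^'n" where
  "mscale c A = map_matrix ((*) c) A"

interpretation mat_vs: vector_space "mscale :: complex \<Rightarrow> complex^'n^'n \<Rightarrow> complex^'n^'n"
  by unfold_locales (simp_all add: mscale_def vec_eq_iff algebra_simps)


section \<open>Linear algebraic groups\<close>

inductive polynomial_fun :: "(complex^'n^'n \<Rightarrow> complex) \<Rightarrow> bool" where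
  const: "polynomial_fun (\<lambda>_. c)"
| entry: "polynomial_fun (\<lambda>A. A $ i $ j)"
| add: "polynomial_fun p \<Longrightarrow> polynomial_fun q \<Longrightarrow> polynomial_fun (\<lambda>A. p A + q A)"
| mult: "polynomial_fun p \<Longrightarrow> polynomial_fun q \<Longrightarrow> polynomial_fun (\<lambda>A. p A * q A)"

definition zariski_open :: "(complex^'n^'n) set \<Rightarrow> bool" where
  "zariski_open U \<longleftrightarrow> (\<exists>P. (\<forall>p\<in>P. polynomial_fun p) \<and> U = {A. invertible A \<and> (\<exists>p\<in>P. p A \<noteq> 0)})"

lemma istopology_zariski_open: "istopology zariski_open"
  unfolding istopology_def
proof (intro conjI allI impI)
  fix S T :: "(complex^'n^'n) set"
  assume "zariski_open S" "zariski_open T"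
  then obtain P Q where P: "\<forall>p\<in>P. polynomial_fun p" "S = {A. invertible A \<and> (\<exists>p\<in>P. p A \<noteq> 0)}"
    and Q: "\<forall>q\<in>Q. polynomial_fun q" "T = {A. invertible A \<and> (\<exists>q\<in>Q. q A \<noteq> 0)}"
    by (auto simp: zariski_open_def)
  define R where "R = (\<lambda>(p, q) A. p A * q A) ` (P \<times> Q)"
  have "\<forall>r\<in>R. polynomial_fun r"
    using P(1) Q(1) by (auto simp: R_def intro: polynomial_fun.mult)
  moreover have "(\<exists>r\<in>R. r A \<noteq> 0) \<longleftrightarrow> (\<exists>p\<in>P. p A \<noteq> 0) \<and> (\<exists>q\<in>Q. q A \<noteq> 0)" for A
    by (simp add: R_def)
  then have "S \<inter> T = {A. invertible A \<and> (\<exists>r\<in>R. r A \<noteq> 0)}"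
    unfolding P(2) Q(2) by auto
  ultimately show "zariski_open (S \<inter> T)"
    unfolding zariski_open_def by (intro exI[of _ R] conjI)
next
  fix \<K> :: "(complex^'n^'n) set set"
  assume *: "\<forall>K\<in>\<K>. zariski_open K"
  define P where "P = {p. polynomial_fun p \<and> {A. invertible A \<and> p A \<noteq> 0} \<subseteq> \<Union>\<K>}"
  have "\<Union>\<K> = {A. invertible A \<and> (\<exists>p\<in>P. p A \<noteq> 0)}"
  proof (intro equalityI subsetI)
    fix A assume "A \<in> \<Union>\<K>"
    then obtain K where K: "K \<in> \<K>" "A \<in> K" by (elim UnionE)
    have "zariski_open K" using K(1) * by simp
    then obtain Q where Q: "\<forall>q\<in>Q. polynomial_fun q" "K = {A. invertible A \<and> (\<exists>q\<in>Q. q A \<noteq> 0)}"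
      by (auto simp: zariski_open_def)
    obtain q where q: "q \<in> Q" "q A \<noteq> 0" "invertible A" using K(2) Q(2) by auto
    have "{A. invertible A \<and> q A \<noteq> 0} \<subseteq> K" using Q(2) q(1) by auto
    then have "q \<in> P" using Q(1) q(1) K(1) by (auto simp: P_def)
    then show "A \<in> {A. invertible A \<and> (\<exists>p\<in>P. p A \<noteq> 0)}" using q(2,3) by auto
  qed (auto simp: P_def)
  moreover have "\<forall>p\<in>P. polynomial_fun p"
    by (simp add: P_def)
  ultimately show "zariski_open (\<Union>\<K>)"
    unfolding zariski_open_def by (intro exI[of _ P] conjI)
qed

definition zariski_GL :: "(complex^'n^'n) topology" where
  "zariski_GL = topology zariski_open"

lemma openin_zariski_GL: "openin zariski_GL U \<longleftrightarrow> zariski_open U"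
  by (simp add: zariski_GL_def istopology_zariski_open)

definition algebraic_group :: "(complex^'n^'n) set \<Rightarrow> bool" where
  "algebraic_group G \<longleftrightarrow> subgroup G GL \<and> closedin zariski_GL G"

definition unipotent :: "complex^'n^'n \<Rightarrow> bool" where
  "unipotent A \<longleftrightarrow> (\<exists>k. (((**) (A - mat 1)) ^^ k) (mat 1) = 0)"

text \<open>
  Reductive means that the unipotent radical, the largest connected normal unipotent closed
  subgroup, is trivial; \<open>G\<close> itself need not be connected.
\<close>

definition reductive :: "(complex^'n^'n) set \<Rightarrow> bool" where
  "reductive G \<longleftrightarrow> algebraic_group G \<and>
     (\<forall>U. algebraic_group U \<and> U \<lhd> (GL\<lparr>carrier := G\<rparr>) \<and> connectedin zariski_GL U \<and>
          (\<forall>A\<in>U. unipotent A) \<longrightarrow> U = {mat 1})"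

text \<open>\<open>represents G f p k\<close>: on \<open>G\<close> the function \<open>f\<close> is the restriction of the regular function
  \<open>p / det ^ k\<close> of the general linear group.\<close>

definition represents ::
    "(complex^'n^'n) set \<Rightarrow> (complex^'n^'n \<Rightarrow> complex) \<Rightarrow> (complex^'n^'n \<Rightarrow> complex) \<Rightarrow> nat \<Rightarrow> bool" where
  "represents G f p k \<longleftrightarrow> polynomial_fun p \<and> (\<forall>g\<in>G. f g = p g / det g ^ k)"

definition rational_representation ::
    "(complex^'n^'n) set \<Rightarrow> (complex^'n^'n \<Rightarrow> complex^'m^'m) \<Rightarrow> bool" where
  "rational_representation G \<rho> \<longleftrightarrow>
     \<rho> \<in> hom (GL\<lparr>carrier := G\<rparr>) GL \<and> (\<forall>i j. \<exists>p k. represents G (\<lambda>g. \<rho> g $ i $ j) p k)"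

definition one_parameter_subgroup ::
    "(complex^'n^'n) set \<Rightarrow> (complex \<Rightarrow> complex^'n^'n) \<Rightarrow> bool" where
  "one_parameter_subgroup G l \<longleftrightarrow>
     l \<in> hom Gm (GL\<lparr>carrier := G\<rparr>) \<and>
     (\<forall>i j. \<exists>(p :: complex poly) k. \<forall>t. t \<noteq> 0 \<longrightarrow> l t $ i $ j = poly p t / t ^ k)"


section \<open>Lie algebras\<close>

definition lie_bracket :: "complex^'n^'n \<Rightarrow> complex^'n^'n \<Rightarrow> complex^'n^'n" where
  "lie_bracket A B = A ** B - B ** A"

definition matrix_lie_algebra :: "(complex^'n^'n) set \<Rightarrow> bool" where
  "matrix_lie_algebra L \<longleftrightarrow> mat_vs.subspace L \<and> (\<forall>A\<in>L. \<forall>B\<in>L. lie_bracket A B \<in> L)"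

definition lie_subalgebra :: "(complex^'n^'n) set \<Rightarrow> (complex^'n^'n) set \<Rightarrow> bool" where
  "lie_subalgebra L M \<longleftrightarrow> matrix_lie_algebra L \<and> matrix_lie_algebra M \<and> L \<subseteq> M"

text \<open>\<open>Lie(G)\<close> is the Zariski tangent space of \<open>G\<close> at the identity.\<close>

definition lie_algebra_of :: "(complex^'n^'n) set \<Rightarrow> (complex^'n^'n) set" where
  "lie_algebra_of G =
     {A. \<forall>p. polynomial_fun p \<and> (\<forall>g\<in>G. p g = 0) \<longrightarrow> deriv (\<lambda>s. p (mat 1 + mscale s A)) 0 = 0}"

text \<open>
  The derivative at the identity of a regular function \<open>f\<close> on \<open>G\<close> along a tangent vector \<open>A\<close> is
  computed from any extension of \<open>f\<close> to a neighbourhood of the identity in the matrices; for \<open>A\<close>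
  in \<open>Lie(G)\<close> the value does not depend on the extension.
\<close>

definition tangent_deriv ::
    "(complex^'n^'n) set \<Rightarrow> (complex^'n^'n \<Rightarrow> complex) \<Rightarrow> complex^'n^'n \<Rightarrow> complex" where
  "tangent_deriv G f A =
     (THE D. \<exists>p k. represents G f p k \<and>
        D = deriv (\<lambda>s. p (mat 1 + mscale s A) / det (mat 1 + mscale s A) ^ k) 0)"

definition differential ::
    "(complex^'n^'n) set \<Rightarrow> (complex^'n^'n \<Rightarrow> complex^'m^'m) \<Rightarrow> complex^'n^'n \<Rightarrow> complex^'m^'m" where
  "differential G \<rho> A = (\<chi> i j. tangent_deriv G (\<lambda>g. \<rho> g $ i $ j) A)"

definition lie_stabilizer ::
    "(complex^'n^'n) set \<Rightarrow> (complex^'n^'n \<Rightarrow> complex^'m^'m) \<Rightarrow> complex^'m \<Rightarrow> (complex^'n^'n) set" where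
  "lie_stabilizer G \<rho> v = {A \<in> lie_algebra_of G. differential G \<rho> A *v v = 0}"

definition orbit_tangent_space ::
    "(complex^'n^'n) set \<Rightarrow> (complex^'n^'n \<Rightarrow> complex^'m^'m) \<Rightarrow> complex^'m \<Rightarrow> (complex^'m) set" where
  "orbit_tangent_space G \<rho> v = {differential G \<rho> A *v v | A. A \<in> lie_algebra_of G}"

text \<open>The stabilizer in \<open>lie_stabilizer G \<rho> z\<close> of the class of \<open>w\<close> in \<open>V / T\<^sub>z O(z)\<close>.\<close>

definition normal_stabilizer ::
    "(complex^'n^'n) set \<Rightarrow> (complex^'n^'n \<Rightarrow> complex^'m^'m) \<Rightarrow> complex^'m \<Rightarrow> complex^'m \<Rightarrow> (complex^'n^'n) set" where
  "normal_stabilizer G \<rho> z w =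
     {A \<in> lie_stabilizer G \<rho> z. differential G \<rho> A *v w \<in> orbit_tangent_space G \<rho> z}"


section \<open>Gradings and leading terms\<close>

definition lie_weight_space ::
    "(complex^'n^'n) set \<Rightarrow> (complex \<Rightarrow> complex^'n^'n) \<Rightarrow> int \<Rightarrow> (complex^'n^'n) set" where
  "lie_weight_space G l j =
     {A \<in> lie_algebra_of G. \<forall>t. t \<noteq> 0 \<longrightarrow> l t ** A ** matrix_inv (l t) = mscale (t powi j) A}"

definition homogeneous_decomposition ::
    "(int \<Rightarrow> 'a::comm_monoid_add set) \<Rightarrow> 'a \<Rightarrow> (int \<Rightarrow> 'a) \<Rightarrow> bool" where
  "homogeneous_decomposition W v c \<longleftrightarrow>
     (\<forall>i. c i \<in> W i) \<and> finite {i. c i \<noteq> 0} \<and> v = (\<Sum>i | c i \<noteq> 0. c i)"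

definition leading_term :: "(int \<Rightarrow> 'a::comm_monoid_add set) \<Rightarrow> 'a \<Rightarrow> 'a" where
  "leading_term W v = (let c = (THE c. homogeneous_decomposition W v c) in c (Min {i. c i \<noteq> 0}))"

definition leading_space ::
    "(complex^'n^'n) set \<Rightarrow> (complex \<Rightarrow> complex^'n^'n) \<Rightarrow> (complex^'n^'n) set \<Rightarrow> (complex^'n^'n) set" where
  "leading_space G l K = mat_vs.span (leading_term (lie_weight_space G l) ` (K - {0}))"

end

theory Submission
  imports Defs
begin

text \<open>
  The idea is to compare coefficients of Laurent polynomials in \<open>t\<close>.
  Write \<open>\<rho> (l t) *v y = (\<Sum>i. t powi i *s v i)\<close>, so \<open>v d = z\<close> and \<open>v e = y\<^sub>e\<close> are the first two nonzero
  coefficients, and let \<open>P j\<close> be the projection of matrices to weight \<open>j\<close> under conjugation by \<open>l\<close>.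
  If \<open>k\<close> annihilates \<open>y\<close>, then \<open>l t ** k ** matrix_inv (l t) = (\<Sum>j. mscale (t powi j) (P j k))\<close>
  annihilates \<open>\<rho> (l t) *v y\<close> for every \<open>t\<close>, because the differential of \<open>\<rho>\<close> is equivariant. Comparing
  coefficients of the resulting Laurent polynomial in \<open>t\<close> gives, for every \<open>m\<close>,
  the equation \<open>(\<Sum>j. P j k \<cdot> v (m - j)) = 0\<close> (lemma \<open>weighted_stabilizer_equation\<close>). Let \<open>a\<close> be the degree of
  the leading term of \<open>k\<close>. For \<open>m = a + d\<close> only one term survives and the equation reads
  \<open>P a k \<cdot> z = 0\<close>. For \<open>m = a + e\<close> at most two survive, and it reads
  \<open>P a k \<cdot> y\<^sub>e = - (P (a + e - d) k \<cdot> z)\<close>, which is tangent to the orbit of \<open>z\<close>. So every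
  leading term lies in the normal stabilizer (\<open>lead_in_normal_stabilizer\<close>), which is a subspace.

  The leading terms span a Lie algebra because the bracket adds degrees: the bracket of two leading
  terms is zero or the leading term of the bracket (\<open>lead_bracket\<close>).

  The dimension is preserved for any subspace of a vector space graded in finitely many degrees
  (\<open>dim_leading_span\<close>): a basis of the span consisting of leading terms, lifted to the
  subspace, gives a linear map that is unitriangular for the grading and hence bijective.

  What these arguments take for granted about algebraic groups is derived from one tool, the
  left-invariant derivations \<open>invariant_deriv A\<close> of the algebra of polynomial functions on matrices.
  They satisfy \<open>[L\<^sub>A, L\<^sub>B] = L\<^bsub>[A, B]\<^esub>\<close>, which shows that \<open>Lie(G)\<close> is a Lie algebra and that
  the differential of a homomorphism with polynomial entries preserves brackets. A rational
  representation becomes such a homomorphism when it is multiplied by a power of the determinant;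
  this changes the differential only by scalar matrices. That \<open>Lie(G)\<close> splits into its weight
  spaces follows since it is cut out by linear equations and is stable under conjugation.
\<close>

section \<open>Leading terms in a graded vector space\<close>

text \<open>
  The grading is given by its projections instead of its homogeneous parts: being defined on
  the whole space, they are linear maps, and a subspace is compared with its leading terms by means of
  components that need not lie in it.
\<close>

locale graded_vector_space = vector_space scale
  for scale :: "'a::field \<Rightarrow> 'b::ab_group_add \<Rightarrow> 'b" +
  fixes S :: "int set" and P :: "int \<Rightarrow> 'b \<Rightarrow> 'b"
  assumes finite_degrees: "finite S"
    and linear_component: "Vector_Spaces.linear scale scale (P j)"
    and component_outside: "j \<notin> S \<Longrightarrow> P j x = 0"
    and sum_components: "(\<Sum>j\<in>S. P j x) = x"
    and component_component: "P i (P j x) = (if i = j then P j x else 0)"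
begin

definition lead :: "'b \<Rightarrow> 'b" where
  "lead x = P (Min {j. P j x \<noteq> 0}) x"

lemmas component_add = module_hom.add[OF linear_component[unfolded module_hom_iff_linear[symmetric]]]
  and component_diff = module_hom.diff[OF linear_component[unfolded module_hom_iff_linear[symmetric]]]
  and component_scale = module_hom.scale[OF linear_component[unfolded module_hom_iff_linear[symmetric]]]
  and component_sum = module_hom.sum[OF linear_component[unfolded module_hom_iff_linear[symmetric]]]
  and component_zero = module_hom.zero[OF linear_component[unfolded module_hom_iff_linear[symmetric]]]

lemma finite_support: "finite {j. P j x \<noteq> 0}"
  using finite_degrees component_outside by (rule_tac finite_subset[of _ S]) auto

lemma eq_0_if_components_0:
  assumes "\<And>j. P j x = 0" shows "x = 0"
  using sum_components[of x] assms by simp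

lemma leadE:
  assumes "x \<noteq> 0"
  obtains a where "lead x = P a x" "P a x \<noteq> 0" "\<And>i. i < a \<Longrightarrow> P i x = 0" "a \<in> S"
proof
  let ?a = "Min {j. P j x \<noteq> 0}"
  have ne: "{j. P j x \<noteq> 0} \<noteq> {}" using assms eq_0_if_components_0 by auto
  show nz: "P ?a x \<noteq> 0" using Min_in[OF finite_support ne] by simp
  show "P i x = 0" if "i < ?a" for i using Min_le[OF finite_support, of i x] that by force
  show "lead x = P ?a x" by (simp add: lead_def)
  show "?a \<in> S" using nz component_outside by blast
qed

lemma lead_eqI:
  assumes "P a x \<noteq> 0" "\<And>i. i < a \<Longrightarrow> P i x = 0"
  shows "lead x = P a x"
proof -
  have "Min {j. P j x \<noteq> 0} = a"
    using assms by (intro Min_eqI finite_support) (auto simp: not_less[symmetric])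
  then show ?thesis by (simp add: lead_def)
qed

text \<open>
  Taking leading terms is not linear, so a basis \<open>B\<close> of the span is chosen among the leading terms and
  the choice of preimages in \<open>K\<close> is extended to a linear map \<open>f\<close>. On an element of degree \<open>j\<close> the map
  \<open>f\<close> is the identity up to terms of degree above \<open>j\<close>. Injectivity is read off from lowest
  components; surjectivity onto \<open>K\<close> follows by clearing components from below, which ends because
  there are only finitely many degrees.
\<close>

lemma dim_leading_span:
  assumes K: "subspace K"
  shows "dim (span (lead ` (K - {0}))) = dim K"
proof -
  interpret pair: vector_space_pair scale scale ..
  obtain B where B: "B \<subseteq> lead ` (K - {0})" "independent B" "lead ` (K - {0}) \<subseteq> span B"
    using maximal_independent_subset by blast
  have spanB: "span (lead ` (K - {0})) = span B"
    using B(1,3) by (intro span_eq[THEN iffD2] conjI) (auto intro: span_base)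
  have "\<forall>b\<in>B. \<exists>k. k \<in> K - {0} \<and> lead k = b" using B(1) by blast
  then obtain \<kappa> where \<kappa>: "\<And>b. b \<in> B \<Longrightarrow> \<kappa> b \<in> K - {0} \<and> lead (\<kappa> b) = b"
    by (auto simp: bchoice_iff)
  obtain f where lin: "Vector_Spaces.linear scale scale f" and f: "\<And>b. b \<in> B \<Longrightarrow> f b = \<kappa> b"
    using pair.linear_independent_extend[OF B(2), of \<kappa>] by auto
  interpret f: Vector_Spaces.linear scale scale f by (rule lin)
  have f_in_K: "f x \<in> K" if "x \<in> span B" for x
  proof -
    have "f ` span B = span (f ` B)" by (simp add: f.span_image)
    also have "\<dots> \<subseteq> K" using \<kappa> f K by (intro span_minimal) auto
    finally show ?thesis using that by blast
  qed
  \<comment> \<open>Unitriangularity; the second half records that the span is a graded subspace.\<close>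
  have tri: "(\<forall>i j. i \<le> j \<longrightarrow> P i (f (P j x)) = (if i = j then P j x else 0)) \<and> (\<forall>j. P j x \<in> span B)"
    if "x \<in> span B" for x
    using that
  proof (induction rule: span_induct_alt)
    case base
    then show ?case by (simp add: component_zero f.zero span_zero)
  next
    case (step c b x)
    have kb: "\<kappa> b \<noteq> 0" "lead (\<kappa> b) = b" using \<kappa> step.hyps by auto
    obtain a where a: "lead (\<kappa> b) = P a (\<kappa> b)" "P a (\<kappa> b) \<noteq> 0" "\<And>i. i < a \<Longrightarrow> P i (\<kappa> b) = 0" "a \<in> S"
      by (rule leadE[OF kb(1)]) blast
    have b: "b = P a (\<kappa> b)" using a(1) kb by simp
    have Pb: "P j b = (if j = a then b else 0)" for j
      by (subst (1 2) b) (simp add: component_component)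
    have "P i (f (P j b)) = (if i = j then P j b else 0)" if "i \<le> j" for i j
      using that f[OF step.hyps] a(3) b by (auto simp: Pb f.zero component_zero)
    moreover have "P j b \<in> span B" for j using step.hyps by (auto simp: Pb span_zero span_base)
    ultimately show ?case
      using step.IH
      by (auto simp: component_add component_scale f.add f.scale span_add span_scale)
  qed
  have comp_f: "P a (f x) = P a x" if "x \<in> span B" "\<And>i. i < a \<Longrightarrow> P i x = 0" for a x
  proof -
    have "P a (f x) = P a (f (\<Sum>j\<in>S. P j x))" by (simp add: sum_components)
    also have "\<dots> = (\<Sum>j\<in>S. P a (f (P j x)))" by (simp add: f.sum component_sum)
    also have "\<dots> = (\<Sum>j\<in>S. if a = j then P j x else 0)"
    proof (rule sum.cong)
      fix j
      show "P a (f (P j x)) = (if a = j then P j x else 0)"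
        using tri[OF that(1)] that(2)[of j] by (cases "a \<le> j") (auto simp: f.zero component_zero)
    qed simp
    also have "\<dots> = P a x" using component_outside by (auto simp: finite_degrees)
    finally show ?thesis .
  qed
  have inj: "inj_on f (span B)"
  proof (subst f.inj_on_iff_eq_0[OF subspace_span], intro ballI impI)
    fix x assume x: "x \<in> span B" "f x = 0"
    show "x = 0"
    proof (rule ccontr)
      assume "x \<noteq> 0"
      then obtain a where "P a x \<noteq> 0" "\<And>i. i < a \<Longrightarrow> P i x = 0" by (rule leadE) blast
      then show False using comp_f[of x a] x by (simp add: component_zero)
    qed
  qed
  obtain M where M: "\<And>j. j \<in> S \<Longrightarrow> j \<le> M"
    using Max_ge[OF finite_degrees] by blast
  \<comment> \<open>Induction on the number of degrees above the known zeros; \<open>f (P a k)\<close> cancels the lowest component of \<open>k\<close>.\<close>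
  have surj: "k \<in> f ` span B" if "k \<in> K" "\<And>i. i \<le> M - int n \<Longrightarrow> P i k = 0" for k n
    using that
  proof (induction n arbitrary: k)
    case 0
    have "P j k = 0" for j using 0(2)[of j] M[of j] component_outside[of j k] by auto
    then have "k = 0" by (rule eq_0_if_components_0)
    then show ?case using f.zero span_zero by (metis imageI)
  next
    case (Suc n)
    define a where "a = M - int n"
    have low: "P i k = 0" if "i < a" for i using Suc.prems(2)[of i] that by (simp add: a_def)
    show ?case
    proof (cases "P a k = 0")
      case True
      have "P i k = 0" if "i \<le> M - int n" for i
        using low[of i] True that by (cases "i = a") (auto simp: a_def)
      then show ?thesis using Suc.IH Suc.prems(1) by blast
    next
      case False
      then have "k \<noteq> 0" "lead k = P a k" using lead_eqI[OF False low] by (auto simp: component_zero)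
      then have h: "P a k \<in> span B" using B(3) Suc.prems(1) by force
      have "k - f (P a k) \<in> f ` span B"
      proof (rule Suc.IH)
        show "k - f (P a k) \<in> K" using K Suc.prems(1) f_in_K[OF h] by (rule subspace_diff)
        fix i assume "i \<le> M - int n"
        then have i: "i \<le> a" by (simp add: a_def)
        have "P i (f (P a k)) = (if i = a then P a k else 0)"
          using tri[OF h] i by (metis component_component)
        then show "P i (k - f (P a k)) = 0" using low[of i] i by (auto simp: component_diff)
      qed
      then obtain u where "u \<in> span B" "k - f (P a k) = f u" by blast
      then have "k = f (u + P a k)" "u + P a k \<in> span B"
        using h by (auto simp: f.add span_add algebra_simps)
      then show ?thesis by blast
    qed
  qed
  have "k \<in> f ` span B" if "k \<in> K" for k
  proof -
    obtain m where m: "\<And>j. j \<in> S \<Longrightarrow> m \<le> j"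
      using Min_le[OF finite_degrees] by blast
    have "P i k = 0" if "i \<le> M - int (nat (M - m + 1))" for i
      using that m[of i] M[of i] component_outside[of i k] by (cases "i \<in> S") auto
    then show ?thesis by (rule surj[OF that])
  qed
  then have "K = f ` span B" using f_in_K by blast
  then have "K = span (f ` B)" by (simp add: f.span_image)
  moreover have "independent (f ` B)" using f.independent_injective_image[OF B(2) inj] .
  moreover have "card (f ` B) = card B" using inj span_superset[of B] by (intro card_image) (rule inj_on_subset)
  ultimately have "dim K = card B" using dim_span_eq_card_independent[of "f ` B"] by simp
  then show ?thesis unfolding spanB using dim_span_eq_card_independent[OF B(2)] by simp
qed

text \<open>
  Homogeneous decompositions are unique, so the definite description in \<open>leading_term\<close> denotes the
  family of components.
\<close>

lemma homogeneous_decomposition_component: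
  assumes W: "\<And>j. W j \<subseteq> {x. P j x = x}" and dec: "homogeneous_decomposition W x u"
  shows "u = (\<lambda>j. P j x)"
proof
  fix i
  have u: "P j (u j) = u j" for j using W dec by (auto simp: homogeneous_decomposition_def)
  have Pu: "P i (u j) = (if i = j then u j else 0)" for j by (metis u component_component)
  have "P i x = (\<Sum>j | u j \<noteq> 0. P i (u j))"
    using dec by (simp add: homogeneous_decomposition_def component_sum)
  also have "\<dots> = u i" using dec by (simp add: Pu homogeneous_decomposition_def)
  finally show "u i = P i x" ..
qed

lemma leading_term_eq_lead:
  assumes W: "\<And>j. W j \<subseteq> {x. P j x = x}" and x: "\<And>j. P j x \<in> W j"
  shows "leading_term W x = lead x"
proof -
  have "x = (\<Sum>j | P j x \<noteq> 0. P j x)"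
    using finite_degrees component_outside
    by (subst (1) sum_components[symmetric], intro sum.mono_neutral_cong_right) auto
  then have "homogeneous_decomposition W x (\<lambda>j. P j x)"
    using x finite_support by (simp add: homogeneous_decomposition_def)
  then have "(THE u. homogeneous_decomposition W x u) = (\<lambda>j. P j x)"
    using homogeneous_decomposition_component[OF W] by (intro the_equality) blast+
  then show ?thesis by (simp add: leading_term_def lead_def)
qed

end

section \<open>Laurent polynomials with vector and matrix coefficients\<close>

text \<open>
  Terms of equal degree may occur several times in the family, as they do in a product of two
  Laurent polynomials indexed by pairs. Multiplication by a large power of \<open>t\<close> turns the sum into a
  polynomial with infinitely many zeros.
\<close>

lemma laurent_coefficients_zero:
  fixes a :: "'i \<Rightarrow> complex" and deg :: "'i \<Rightarrow> int"
  assumes I: "finite I" and zero: "\<And>t. t \<noteq> 0 \<Longrightarrow> (\<Sum>x\<in>I. t powi deg x * a x) = 0"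
  shows "(\<Sum>x | x \<in> I \<and> deg x = m. a x) = 0"
proof -
  \<comment> \<open>Large enough that every exponent \<open>deg x + N\<close>, and \<open>m + N\<close> too, is a natural number.\<close>
  define N where "N = (\<Sum>x\<in>I. \<bar>deg x\<bar>) + \<bar>m\<bar>"
  have N: "0 \<le> deg x + N" if "x \<in> I" for x
    using member_le_sum[of x I "\<lambda>x. \<bar>deg x\<bar>"] I that by (auto simp: N_def)
  have mN: "0 \<le> m + N"
  proof -
    have "0 \<le> (\<Sum>x\<in>I. \<bar>deg x\<bar>)" by (simp add: sum_nonneg)
    then show ?thesis unfolding N_def by linarith
  qed
  define p where "p = (\<Sum>x\<in>I. monom (a x) (nat (deg x + N)))"
  have "poly p t = 0" if "t \<noteq> 0" for t
  proof -
    have "poly p t = (\<Sum>x\<in>I. a x * t ^ nat (deg x + N))"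
      by (simp add: p_def poly_sum poly_monom)
    also have "\<dots> = (\<Sum>x\<in>I. t powi N * (t powi deg x * a x))"
    proof (rule sum.cong)
      fix x assume "x \<in> I"
      then have "t ^ nat (deg x + N) = t powi (deg x + N)" using N by (simp add: power_int_def)
      then show "a x * t ^ nat (deg x + N) = t powi N * (t powi deg x * a x)"
        using that by (simp add: power_int_add)
    qed simp
    also have "\<dots> = t powi N * (\<Sum>x\<in>I. t powi deg x * a x)"
      by (simp add: sum_distrib_left)
    also have "\<dots> = 0" using zero[OF that] by simp
    finally show ?thesis .
  qed
  then have "- {0} \<subseteq> {t. poly p t = 0}" by auto
  moreover have "infinite (- {0 :: complex})"
    by (simp add: infinite_UNIV_char_0 finite_compl)
  ultimately have "p = 0"
    using poly_roots_finite[of p] finite_subset by blast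
  then have "0 = coeff p (nat (m + N))" by simp
  also have "\<dots> = (\<Sum>x\<in>I. if deg x = m then a x else 0)"
    using N mN by (simp add: p_def coeff_sum, intro sum.cong) (auto simp: nat_eq_iff2)
  also have "\<dots> = (\<Sum>x | x \<in> I \<and> deg x = m. a x)"
    using I by (simp add: sum.If_cases Int_def)
  finally show ?thesis by simp
qed

lemma laurent_vector_coefficients_zero:
  fixes a :: "'i \<Rightarrow> complex^'m" and deg :: "'i \<Rightarrow> int"
  assumes I: "finite I" and zero: "\<And>t. t \<noteq> 0 \<Longrightarrow> (\<Sum>x\<in>I. (t powi deg x) *s a x) = 0"
  shows "(\<Sum>x | x \<in> I \<and> deg x = m. a x) = 0"
proof (simp only: vec_eq_iff, intro allI)
  fix i
  have "(\<Sum>x | x \<in> I \<and> deg x = m. a x $ i) = 0"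
    using I by (rule laurent_coefficients_zero) (use zero in \<open>simp add: vec_eq_iff\<close>)
  then show "(\<Sum>x | x \<in> I \<and> deg x = m. a x) $ i = 0 $ i" by simp
qed

lemma mscale_nth [simp]: "mscale c A $ i $ j = c * A $ i $ j"
  by (simp add: mscale_def)

lemma laurent_matrix_coefficients_zero:
  fixes a :: "'i \<Rightarrow> complex^'n^'n" and deg :: "'i \<Rightarrow> int"
  assumes I: "finite I" and zero: "\<And>t. t \<noteq> 0 \<Longrightarrow> (\<Sum>x\<in>I. mscale (t powi deg x) (a x)) = 0"
  shows "(\<Sum>x | x \<in> I \<and> deg x = m. a x) = 0"
proof (simp only: vec_eq_iff, intro allI)
  fix i j
  have "(\<Sum>x | x \<in> I \<and> deg x = m. a x $ i $ j) = 0"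
    using I by (rule laurent_coefficients_zero) (use zero in \<open>simp add: vec_eq_iff\<close>)
  then show "(\<Sum>x | x \<in> I \<and> deg x = m. a x) $ i $ j = 0 $ i $ j" by simp
qed

text \<open>
  The bound \<open>N\<close> may be exceeded freely, so that finitely many such expansions can share one range of
  exponents.
\<close>

lemma laurent_expansion:
  fixes p :: "complex poly"
  obtains a N where "\<And>K t. N \<le> K \<Longrightarrow> t \<noteq> 0 \<Longrightarrow>
    poly p t / t ^ k = (\<Sum>i\<in>{- int K..int K}. t powi i * a i)"
proof
  define a where "a i = (if - int k \<le> i then coeff p (nat (i + int k)) else 0)" for i
  fix K t assume K: "degree p + k \<le> K" and t: "t \<noteq> (0 :: complex)"
  have "poly p t / t ^ k = (\<Sum>n\<le>degree p. t powi (int n - int k) * a (int n - int k))"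
    unfolding poly_altdef sum_divide_distrib
    by (intro sum.cong) (auto simp: a_def power_int_diff t)
  also have "\<dots> = (\<Sum>i\<in>(\<lambda>n. int n - int k) ` {..degree p}. t powi i * a i)"
    by (subst sum.reindex) (auto simp: inj_on_def)
  also have "\<dots> = (\<Sum>i\<in>{- int K..int K}. t powi i * a i)"
  proof (rule sum.mono_neutral_left)
    show "\<forall>i\<in>{- int K..int K} - (\<lambda>n. int n - int k) ` {..degree p}. t powi i * a i = 0"
    proof
      fix i assume i: "i \<in> {- int K..int K} - (\<lambda>n. int n - int k) ` {..degree p}"
      have "coeff p (nat (i + int k)) = 0" if "- int k \<le> i"
      proof (rule coeff_eq_0, rule ccontr)
        assume "\<not> degree p < nat (i + int k)"
        then have "i = int (nat (i + int k)) - int k" "nat (i + int k) \<in> {..degree p}"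
          using that by auto
        then show False using i by blast
      qed
      then show "t powi i * a i = 0" by (simp add: a_def)
    qed
  qed (use K in auto)
  finally show "poly p t / t ^ k = (\<Sum>i\<in>{- int K..int K}. t powi i * a i)" .
qed

lemma laurent_matrix_unique:
  fixes a b :: "int \<Rightarrow> complex^'n^'n"
  assumes S: "finite S" "j \<in> S"
    and eq: "\<And>t. t \<noteq> 0 \<Longrightarrow>
      (\<Sum>i\<in>S. mscale (t powi i) (a i)) = (\<Sum>i\<in>S. mscale (t powi i) (b i))"
  shows "a j = b j"
proof -
  have "(\<Sum>i | i \<in> S \<and> i = j. a i - b i) = 0"
    using S(1) by (rule laurent_matrix_coefficients_zero)
      (simp add: mat_vs.scale_right_diff_distrib sum_subtractf eq)
  moreover have "{i. i \<in> S \<and> i = j} = {j}" using S(2) by auto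
  ultimately show ?thesis by simp
qed

section \<open>Invariant derivations of polynomial functions\<close>

lemma mscale_mult_left: "mscale c A ** B = mscale c (A ** B)"
  by (simp add: vec_eq_iff matrix_matrix_mult_def sum_distrib_left mult.assoc)

lemma mscale_mult_right: "A ** mscale c B = mscale c (A ** B)"
  by (simp add: vec_eq_iff matrix_matrix_mult_def sum_distrib_left mult.left_commute)

lemma mscale_mult_vector: "mscale c A *v x = c *s (A *v x)"
  by (simp add: vec_eq_iff matrix_vector_mult_def sum_distrib_left mult.assoc)

lemma matrix_mult_add_left: "(A + B) ** C = A ** C + B ** C" for A :: "complex^'n^'m"
  by (simp add: vec_eq_iff matrix_matrix_mult_def distrib_right sum.distrib)

lemma matrix_mult_diff_left: "(A - B) ** C = A ** C - B ** C" for A :: "complex^'n^'m"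
  by (simp add: vec_eq_iff matrix_matrix_mult_def left_diff_distrib sum_subtractf)

lemma matrix_mult_diff_right: "A ** (B - C) = A ** B - A ** C" for A :: "complex^'n^'m"
  by (simp add: vec_eq_iff matrix_matrix_mult_def right_diff_distrib sum_subtractf)

lemma matrix_mult_sum_left: "(\<Sum>x\<in>I. f x) ** B = (\<Sum>x\<in>I. f x ** B)" for B :: "complex^'n^'n"
  by (induction I rule: infinite_finite_induct) (simp_all add: matrix_mult_add_left)

lemma matrix_mult_sum_right: "B ** (\<Sum>x\<in>I. f x) = (\<Sum>x\<in>I. B ** f x)" for B :: "complex^'n^'n"
  by (induction I rule: infinite_finite_induct) (simp_all add: matrix_add_ldistrib)

lemma polynomial_fun_sum:
  "(\<And>x. x \<in> I \<Longrightarrow> polynomial_fun (p x)) \<Longrightarrow> polynomial_fun (\<lambda>X. \<Sum>x\<in>I. p x X)"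
  by (induction I rule: infinite_finite_induct) (auto intro: polynomial_fun.intros)

lemma polynomial_fun_prod:
  "(\<And>x. x \<in> I \<Longrightarrow> polynomial_fun (p x)) \<Longrightarrow> polynomial_fun (\<lambda>X. \<Prod>x\<in>I. p x X)"
  by (induction I rule: infinite_finite_induct) (auto intro: polynomial_fun.intros)

lemma polynomial_fun_power: "polynomial_fun p \<Longrightarrow> polynomial_fun (\<lambda>X. p X ^ k)"
  by (induction k) (auto intro: polynomial_fun.intros)

lemma polynomial_fun_diff:
  "polynomial_fun p \<Longrightarrow> polynomial_fun q \<Longrightarrow> polynomial_fun (\<lambda>X. p X - q X)"
  using polynomial_fun.add[OF _ polynomial_fun.mult[OF polynomial_fun.const[of "-1"]]] by fastforce

lemma polynomial_fun_det: "polynomial_fun det"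
  unfolding det_def
  by (intro polynomial_fun_sum polynomial_fun_prod polynomial_fun.intros)

lemma polynomial_fun_two_sided_mult:
  assumes "polynomial_fun p"
  shows "polynomial_fun (\<lambda>X. p (g ** X ** h))"
  using assms
proof induction
  case (entry i j)
  show ?case
    unfolding matrix_matrix_mult_def
    by (simp, intro polynomial_fun_sum polynomial_fun.intros)
qed (auto intro: polynomial_fun.intros)

text \<open>
  The left-invariant vector field of \<open>A\<close> on the general linear group, applied to \<open>p\<close>. Perturbing \<open>X\<close>
  multiplicatively makes it commute with left translations; at the identity it is the
  derivative along \<open>A\<close> by which \<open>Lie(G)\<close> is defined.
\<close>

definition invariant_deriv ::
    "complex^'n^'n \<Rightarrow> (complex^'n^'n \<Rightarrow> complex) \<Rightarrow> complex^'n^'n \<Rightarrow> complex" where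
  "invariant_deriv A p X = deriv (\<lambda>s. p (X ** (mat 1 + mscale s A))) 0"

lemma has_invariant_deriv:
  assumes "polynomial_fun p"
  shows "((\<lambda>s. p (X ** (mat 1 + mscale s A))) has_field_derivative invariant_deriv A p X) (at 0)"
proof -
  have "\<exists>D. ((\<lambda>s. p (X ** (mat 1 + mscale s A))) has_field_derivative D) (at 0)"
    using assms
  proof induction
    case (const c)
    show ?case by (auto intro!: derivative_eq_intros)
  next
    case (entry i j)
    have "((\<lambda>s. (X + mscale s (X ** A)) $ i $ j) has_field_derivative (X ** A) $ i $ j) (at 0)"
      by (auto intro!: derivative_eq_intros)
    then show ?case by (auto simp: matrix_add_ldistrib mscale_mult_right)
  next
    case (add p q)
    then show ?case using DERIV_add by fast
  next
    case (mult p q)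
    then show ?case using DERIV_mult by fast
  qed
  then show ?thesis unfolding invariant_deriv_def by (metis DERIV_imp_deriv)
qed

lemma invariant_deriv_const: "invariant_deriv A (\<lambda>_. c) X = 0"
  by (simp add: invariant_deriv_def)

lemma invariant_deriv_entry: "invariant_deriv A (\<lambda>X. X $ i $ j) X = (X ** A) $ i $ j"
proof -
  have "((\<lambda>s. (X + mscale s (X ** A)) $ i $ j) has_field_derivative (X ** A) $ i $ j) (at 0)"
    by (auto intro!: derivative_eq_intros)
  then show ?thesis
    by (simp add: invariant_deriv_def matrix_add_ldistrib mscale_mult_right DERIV_imp_deriv)
qed

lemma invariant_deriv_add:
  assumes "polynomial_fun p" "polynomial_fun q"
  shows "invariant_deriv A (\<lambda>X. p X + q X) = (\<lambda>X. invariant_deriv A p X + invariant_deriv A q X)"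
  using DERIV_add[OF assms[THEN has_invariant_deriv]]
  by (simp add: fun_eq_iff invariant_deriv_def[of A "\<lambda>X. p X + q X"] DERIV_imp_deriv)

lemma invariant_deriv_diff:
  assumes "polynomial_fun p" "polynomial_fun q"
  shows "invariant_deriv A (\<lambda>X. p X - q X) X = invariant_deriv A p X - invariant_deriv A q X"
  using DERIV_diff[OF assms[THEN has_invariant_deriv]]
  by (simp add: invariant_deriv_def[of A "\<lambda>X. p X - q X"] DERIV_imp_deriv)

lemma invariant_deriv_mult:
  assumes "polynomial_fun p" "polynomial_fun q"
  shows "invariant_deriv A (\<lambda>X. p X * q X) =
    (\<lambda>X. invariant_deriv A p X * q X + p X * invariant_deriv A q X)"
  using DERIV_mult[OF assms[THEN has_invariant_deriv], of _ A _ A]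
  by (simp add: fun_eq_iff invariant_deriv_def[of A "\<lambda>X. p X * q X"] DERIV_imp_deriv mult.commute)

lemma invariant_deriv_cmult:
  assumes "polynomial_fun p"
  shows "invariant_deriv A (\<lambda>X. c * p X) X = c * invariant_deriv A p X"
  using assms by (simp add: invariant_deriv_mult polynomial_fun.const invariant_deriv_const)

lemma invariant_deriv_sum:
  assumes "\<And>x. x \<in> I \<Longrightarrow> polynomial_fun (p x)"
  shows "invariant_deriv A (\<lambda>X. \<Sum>x\<in>I. p x X) X = (\<Sum>x\<in>I. invariant_deriv A (p x) X)"
  using assms
  by (induction I rule: infinite_finite_induct)
     (simp_all add: invariant_deriv_const invariant_deriv_add polynomial_fun_sum)

lemma polynomial_fun_invariant_deriv:
  assumes "polynomial_fun p" shows "polynomial_fun (invariant_deriv A p)"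
  using assms
proof induction
  case (entry i j)
  have "polynomial_fun (\<lambda>X. \<Sum>k\<in>UNIV. X $ i $ k * A $ k $ j)"
    by (intro polynomial_fun_sum polynomial_fun.intros)
  then show ?case by (simp add: invariant_deriv_entry[abs_def] matrix_matrix_mult_def)
next
  case (const c)
  show ?case using polynomial_fun.const[of 0] by (simp add: invariant_deriv_const[abs_def])
next
  case (add p q)
  then show ?case by (simp add: invariant_deriv_add polynomial_fun.add)
next
  case (mult p q)
  then show ?case
    by (simp add: invariant_deriv_mult polynomial_fun.add polynomial_fun.mult)
qed

lemma invariant_deriv_direction_add:
  assumes "polynomial_fun p"
  shows "invariant_deriv (A + B) p X = invariant_deriv A p X + invariant_deriv B p X"
  using assms
  by induction (simp_all add: invariant_deriv_const invariant_deriv_entry invariant_deriv_add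
      invariant_deriv_mult matrix_add_ldistrib algebra_simps)

lemma invariant_deriv_direction_scale:
  assumes "polynomial_fun p"
  shows "invariant_deriv (mscale c A) p X = c * invariant_deriv A p X"
  using assms
  by induction (simp_all add: invariant_deriv_const invariant_deriv_entry invariant_deriv_add
      invariant_deriv_mult mscale_mult_right algebra_simps)

text \<open>
  The commutator of two derivations is a derivation, so the equality spreads from the matrix entries
  to all polynomial functions. On entries it says
  \<open>X ** A ** B - X ** B ** A = X ** lie_bracket A B\<close>.
\<close>

lemma invariant_deriv_bracket:
  assumes "polynomial_fun p"
  shows "invariant_deriv (lie_bracket A B) p X =
    invariant_deriv A (invariant_deriv B p) X - invariant_deriv B (invariant_deriv A p) X"
  using assms
proof induction
  case (const c)
  show ?case by (simp add: invariant_deriv_const[abs_def])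
next
  case (entry i j)
  have *: "invariant_deriv A (invariant_deriv B (\<lambda>X. X $ i $ j)) X = (X ** A ** B) $ i $ j" for A B
  proof -
    have "invariant_deriv A (invariant_deriv B (\<lambda>X. X $ i $ j)) X
        = invariant_deriv A (\<lambda>X. \<Sum>k\<in>UNIV. B $ k $ j * X $ i $ k) X"
      by (simp add: invariant_deriv_entry[abs_def] matrix_matrix_mult_def mult.commute)
    also have "\<dots> = (\<Sum>k\<in>UNIV. B $ k $ j * (X ** A) $ i $ k)"
      by (simp add: invariant_deriv_sum invariant_deriv_cmult invariant_deriv_entry polynomial_fun.intros)
    also have "\<dots> = (X ** A ** B) $ i $ j"
      by (simp add: matrix_matrix_mult_def[of "X ** A"] mult.commute)
    finally show ?thesis .
  qed
  show ?case
    unfolding * by (simp add: invariant_deriv_entry lie_bracket_def matrix_mul_assoc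
        matrix_mult_diff_right)
next
  case (add p q)
  then show ?case
    by (simp add: invariant_deriv_add polynomial_fun_invariant_deriv)
next
  case (mult p q)
  then show ?case
    by (simp add: invariant_deriv_mult invariant_deriv_add polynomial_fun_invariant_deriv
        polynomial_fun.mult) (simp add: algebra_simps)
qed

lemma invariant_deriv_left_translate:
  "invariant_deriv A (\<lambda>X. p (g ** X)) X = invariant_deriv A p (g ** X)"
  by (simp add: invariant_deriv_def matrix_mul_assoc)

lemma invariant_deriv_conjugate:
  fixes g :: "complex^'n^'n"
  assumes "g ** h = mat 1"
  shows "invariant_deriv A (\<lambda>X. p (g ** X ** h)) (mat 1) = invariant_deriv (g ** A ** h) p (mat 1)"
  using assms
  by (simp add: invariant_deriv_def matrix_add_ldistrib matrix_mult_add_left mscale_mult_left mscale_mult_right)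

lemma invariant_deriv_det: "invariant_deriv A det X = det X * invariant_deriv A det (mat 1)"
  using DERIV_cmult[OF has_invariant_deriv[OF polynomial_fun_det, of "mat 1" A], of "det X"]
  by (simp add: invariant_deriv_def[of A det X] det_mul DERIV_imp_deriv)

text \<open>
  The determinant is an eigenfunction of every left-invariant derivation (the eigenvalue is the
  trace), and scalars commute.
\<close>

lemma invariant_deriv_det_bracket: "invariant_deriv (lie_bracket A B) det (mat 1) = 0"
proof -
  have swap: "invariant_deriv A (invariant_deriv B det) (mat 1)
      = invariant_deriv A det (mat 1) * invariant_deriv B det (mat 1)" for A B :: "complex^'n^'n"
  proof -
    have "invariant_deriv B det = (\<lambda>X. invariant_deriv B det (mat 1) * det X)"
      by (intro ext trans[OF invariant_deriv_det mult.commute])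
    then have "invariant_deriv A (invariant_deriv B det) (mat 1) =
        invariant_deriv A (\<lambda>X. invariant_deriv B det (mat 1) * det X) (mat 1)"
      by (rule arg_cong)
    also have "\<dots> = invariant_deriv B det (mat 1) * invariant_deriv A det (mat 1)"
      by (rule invariant_deriv_cmult[OF polynomial_fun_det])
    finally show ?thesis by (simp only: mult.commute)
  qed
  show ?thesis by (simp add: invariant_deriv_bracket[OF polynomial_fun_det] swap[of A B] swap[of B A])
qed

lemma invariant_deriv_det_conjugate:
  fixes g :: "complex^'n^'n"
  assumes "g ** h = mat 1"
  shows "invariant_deriv (g ** A ** h) det (mat 1) = invariant_deriv A det (mat 1)"
proof -
  have "det g * det h = 1" using assms by (metis det_I det_mul)
  then have "(\<lambda>X. det (g ** X ** h)) = det" by (simp add: fun_eq_iff det_mul)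
  then show ?thesis using invariant_deriv_conjugate[OF assms, of A det] by simp
qed

section \<open>The Lie algebra of a linear algebraic group\<close>

lemma subgroup_GL_facts:
  assumes "subgroup G GL"
  shows "mat 1 \<in> G"
    and "g \<in> G \<Longrightarrow> h \<in> G \<Longrightarrow> g ** h \<in> G"
    and "g \<in> G \<Longrightarrow> det g \<noteq> 0"
  using subgroup.one_closed[OF assms] subgroup.m_closed[OF assms, of g h] subgroup.subset[OF assms]
  by (auto simp: GL_def invertible_det_nz)

lemma lie_algebra_of_iff:
  "A \<in> lie_algebra_of G \<longleftrightarrow>
     (\<forall>p. polynomial_fun p \<longrightarrow> (\<forall>g\<in>G. p g = 0) \<longrightarrow> invariant_deriv A p (mat 1) = 0)"
  by (auto simp: lie_algebra_of_def invariant_deriv_def)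

lemma subspace_lie_algebra_of: "mat_vs.subspace (lie_algebra_of G)"
proof (rule mat_vs.subspaceI)
  show "0 \<in> lie_algebra_of G" by (simp add: lie_algebra_of_def)
qed (auto simp: lie_algebra_of_iff invariant_deriv_direction_add invariant_deriv_direction_scale)

text \<open>
  The tangent space condition at the identity is carried to any \<open>g\<close> in \<open>G\<close> by the left translation
  with \<open>g\<close>, which preserves the ideal of \<open>G\<close>. Hence \<open>invariant_deriv A\<close> maps this ideal to itself.
\<close>

lemma invariant_deriv_vanishes:
  assumes G: "subgroup G GL" and A: "A \<in> lie_algebra_of G"
    and p: "polynomial_fun p" "\<And>g. g \<in> G \<Longrightarrow> p g = 0" and g: "g \<in> G"
  shows "invariant_deriv A p g = 0"
proof -
  have "polynomial_fun (\<lambda>X. p (g ** X))"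
    using polynomial_fun_two_sided_mult[OF p(1), of g "mat 1"] by simp
  then have "invariant_deriv A (\<lambda>X. p (g ** X)) (mat 1) = 0"
    using A p(2) g subgroup_GL_facts(2)[OF G] by (auto simp: lie_algebra_of_iff)
  then show ?thesis by (simp add: invariant_deriv_left_translate)
qed

lemma lie_bracket_in_lie_algebra_of:
  assumes G: "subgroup G GL" and A: "A \<in> lie_algebra_of G" and B: "B \<in> lie_algebra_of G"
  shows "lie_bracket A B \<in> lie_algebra_of G"
  unfolding lie_algebra_of_iff
proof (intro allI impI)
  fix p assume p: "polynomial_fun p" "\<forall>g\<in>G. p g = 0"
  have "invariant_deriv A (invariant_deriv B p) (mat 1) = 0"
    if "A \<in> lie_algebra_of G" "B \<in> lie_algebra_of G" for A B
    using that(1) polynomial_fun_invariant_deriv[OF p(1)] invariant_deriv_vanishes[OF G that(2) p(1)] p(2)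
    by (auto simp: lie_algebra_of_iff)
  then show "invariant_deriv (lie_bracket A B) p (mat 1) = 0"
    using A B by (simp add: invariant_deriv_bracket[OF p(1)])
qed

lemma conjugate_in_lie_algebra_of:
  assumes G: "subgroup G GL" and A: "A \<in> lie_algebra_of G"
    and gh: "g \<in> G" "h \<in> G" "g ** h = mat 1"
  shows "g ** A ** h \<in> lie_algebra_of G"
  unfolding lie_algebra_of_iff
proof (intro allI impI)
  fix p assume p: "polynomial_fun p" "\<forall>g\<in>G. p g = 0"
  have "polynomial_fun (\<lambda>X. p (g ** X ** h))"
    using p(1) by (rule polynomial_fun_two_sided_mult)
  moreover have "\<forall>x\<in>G. p (g ** x ** h) = 0"
    using p(2) gh subgroup_GL_facts(2)[OF G] by blast
  ultimately have "invariant_deriv A (\<lambda>X. p (g ** X ** h)) (mat 1) = 0"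
    using A unfolding lie_algebra_of_iff by blast
  then show "invariant_deriv (g ** A ** h) p (mat 1) = 0"
    by (simp add: invariant_deriv_conjugate[OF gh(3)])
qed

section \<open>Homomorphisms with polynomial entries\<close>

text \<open>
  Derivatives along \<open>Lie(G)\<close> depend only on the values on \<open>G\<close>. The identities below for
  homomorphisms are obtained by differentiating equations that hold on \<open>G\<close> alone.
\<close>

lemma invariant_deriv_cong_on_group:
  assumes G: "subgroup G GL" and A: "A \<in> lie_algebra_of G"
    and pq: "polynomial_fun p" "polynomial_fun q" "\<And>g. g \<in> G \<Longrightarrow> p g = q g"
  shows "invariant_deriv A p (mat 1) = invariant_deriv A q (mat 1)"
proof -
  have "invariant_deriv A (\<lambda>X. p X - q X) (mat 1) = 0"
    using pq by (intro invariant_deriv_vanishes[OF G A] polynomial_fun_diff subgroup_GL_facts(1)[OF G]) auto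
  then show ?thesis by (simp add: invariant_deriv_diff pq)
qed

definition matrix_deriv ::
    "complex^'n^'n \<Rightarrow> (complex^'n^'n \<Rightarrow> complex^'m^'m) \<Rightarrow> complex^'n^'n \<Rightarrow> complex^'m^'m" where
  "matrix_deriv A Q X = (\<chi> i j. invariant_deriv A (\<lambda>Y. Q Y $ i $ j) X)"

locale polynomial_homomorphism =
  fixes G :: "(complex^'n^'n) set" and Q :: "complex^'n^'n \<Rightarrow> complex^'m^'m"
  assumes subgroup: "subgroup G GL"
    and polynomial: "polynomial_fun (\<lambda>X. Q X $ i $ j)"
    and mult: "g \<in> G \<Longrightarrow> h \<in> G \<Longrightarrow> Q (g ** h) = Q g ** Q h"
begin

lemma matrix_deriv_add:
  "matrix_deriv (A + B) Q X = matrix_deriv A Q X + matrix_deriv B Q X"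
  by (simp add: vec_eq_iff matrix_deriv_def invariant_deriv_direction_add polynomial)

lemma matrix_deriv_scale:
  "matrix_deriv (mscale c A) Q X = mscale c (matrix_deriv A Q X)"
  by (simp add: vec_eq_iff matrix_deriv_def invariant_deriv_direction_scale polynomial)

text \<open>
  Differentiate \<open>Q (g ** X) = Q g ** Q X\<close> with respect to \<open>X\<close> at the identity.
\<close>

lemma matrix_deriv_left_invariant:
  assumes A: "A \<in> lie_algebra_of G" and g: "g \<in> G"
  shows "matrix_deriv A Q g = Q g ** matrix_deriv A Q (mat 1)"
proof -
  have "invariant_deriv A (\<lambda>Y. Q Y $ i $ j) g = (Q g ** matrix_deriv A Q (mat 1)) $ i $ j" for i j
  proof -
    have "invariant_deriv A (\<lambda>Y. Q Y $ i $ j) g = invariant_deriv A (\<lambda>Y. Q (g ** Y) $ i $ j) (mat 1)"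
      using invariant_deriv_left_translate[of A "\<lambda>Y. Q Y $ i $ j" g "mat 1"] by simp
    also have "\<dots> = invariant_deriv A (\<lambda>Y. \<Sum>k\<in>UNIV. Q g $ i $ k * Q Y $ k $ j) (mat 1)"
    proof (rule invariant_deriv_cong_on_group[OF subgroup A])
      show "polynomial_fun (\<lambda>Y. Q (g ** Y) $ i $ j)"
        using polynomial_fun_two_sided_mult[OF polynomial, of g "mat 1"] by simp
      show "polynomial_fun (\<lambda>Y. \<Sum>k\<in>UNIV. Q g $ i $ k * Q Y $ k $ j)"
        by (intro polynomial_fun_sum polynomial_fun.mult polynomial_fun.const polynomial)
      show "Q (g ** x) $ i $ j = (\<Sum>k\<in>UNIV. Q g $ i $ k * Q x $ k $ j)" if "x \<in> G" for x
        unfolding mult[OF g that] by (simp add: matrix_matrix_mult_def)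
    qed
    also have "\<dots> = (\<Sum>k\<in>UNIV. Q g $ i $ k * invariant_deriv A (\<lambda>Y. Q Y $ k $ j) (mat 1))"
      by (simp add: invariant_deriv_sum invariant_deriv_cmult polynomial polynomial_fun.mult
          polynomial_fun.const)
    finally show ?thesis by (simp add: matrix_matrix_mult_def matrix_deriv_def)
  qed
  then show ?thesis by (simp add: vec_eq_iff matrix_deriv_def)
qed

text \<open>
  By left invariance \<open>matrix_deriv B Q\<close> agrees on \<open>G\<close> with \<open>Q\<close> times a constant matrix, so it can be
  differentiated a second time along \<open>Lie(G)\<close>. The bracket formula is the antisymmetric part.
\<close>

lemma matrix_deriv_twice:
  assumes A: "A \<in> lie_algebra_of G" and B: "B \<in> lie_algebra_of G"
  shows "matrix_deriv A (matrix_deriv B Q) (mat 1) = matrix_deriv A Q (mat 1) ** matrix_deriv B Q (mat 1)"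
proof -
  define M where "M = matrix_deriv B Q (mat 1)"
  have "invariant_deriv A (\<lambda>X. matrix_deriv B Q X $ i $ j) (mat 1) = (matrix_deriv A Q (mat 1) ** M) $ i $ j" for i j
  proof -
    have "invariant_deriv A (\<lambda>X. matrix_deriv B Q X $ i $ j) (mat 1)
        = invariant_deriv A (\<lambda>X. \<Sum>k\<in>UNIV. M $ k $ j * Q X $ i $ k) (mat 1)"
    proof (rule invariant_deriv_cong_on_group[OF subgroup A])
      show "polynomial_fun (\<lambda>X. matrix_deriv B Q X $ i $ j)"
        using polynomial_fun_invariant_deriv[OF polynomial] by (simp add: matrix_deriv_def)
      show "polynomial_fun (\<lambda>X. \<Sum>k\<in>UNIV. M $ k $ j * Q X $ i $ k)"
        by (intro polynomial_fun_sum polynomial_fun.mult polynomial_fun.const polynomial)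
      show "matrix_deriv B Q g $ i $ j = (\<Sum>k\<in>UNIV. M $ k $ j * Q g $ i $ k)" if "g \<in> G" for g
        by (simp add: matrix_deriv_left_invariant[OF B that] M_def matrix_matrix_mult_def mult.commute)
    qed
    also have "\<dots> = (\<Sum>k\<in>UNIV. M $ k $ j * invariant_deriv A (\<lambda>X. Q X $ i $ k) (mat 1))"
      by (simp add: invariant_deriv_sum invariant_deriv_cmult polynomial polynomial_fun.mult
          polynomial_fun.const)
    finally show ?thesis by (simp add: matrix_matrix_mult_def matrix_deriv_def mult.commute)
  qed
  then show ?thesis by (simp add: vec_eq_iff matrix_deriv_def[of A "matrix_deriv B Q"] M_def)
qed

lemma matrix_deriv_bracket:
  assumes "A \<in> lie_algebra_of G" "B \<in> lie_algebra_of G"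
  shows "matrix_deriv (lie_bracket A B) Q (mat 1) =
    lie_bracket (matrix_deriv A Q (mat 1)) (matrix_deriv B Q (mat 1))"
proof -
  have "matrix_deriv (lie_bracket A B) Q (mat 1) =
      matrix_deriv A (matrix_deriv B Q) (mat 1) - matrix_deriv B (matrix_deriv A Q) (mat 1)"
    by (simp add: vec_eq_iff matrix_deriv_def invariant_deriv_bracket polynomial)
  then show ?thesis using assms by (simp add: matrix_deriv_twice lie_bracket_def)
qed

lemma matrix_deriv_conjugate:
  assumes A: "A \<in> lie_algebra_of G" and gh: "g \<in> G" "h \<in> G" "g ** h = mat 1"
  shows "matrix_deriv (g ** A ** h) Q (mat 1) = Q g ** matrix_deriv A Q (mat 1) ** Q h"
proof -
  have "invariant_deriv (g ** A ** h) (\<lambda>X. Q X $ i $ j) (mat 1) =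
      (Q g ** matrix_deriv A Q (mat 1) ** Q h) $ i $ j" for i j
  proof -
    have "invariant_deriv (g ** A ** h) (\<lambda>X. Q X $ i $ j) (mat 1)
        = invariant_deriv A (\<lambda>X. Q (g ** X ** h) $ i $ j) (mat 1)"
      using invariant_deriv_conjugate[OF gh(3), of A "\<lambda>X. Q X $ i $ j"] by simp
    also have "\<dots> = invariant_deriv A
        (\<lambda>X. \<Sum>k\<in>UNIV. Q h $ k $ j * (\<Sum>m\<in>UNIV. Q g $ i $ m * Q X $ m $ k)) (mat 1)"
    proof (rule invariant_deriv_cong_on_group[OF subgroup A])
      show "polynomial_fun (\<lambda>X. Q (g ** X ** h) $ i $ j)"
        by (rule polynomial_fun_two_sided_mult[OF polynomial])
      show "polynomial_fun (\<lambda>X. \<Sum>k\<in>UNIV. Q h $ k $ j * (\<Sum>m\<in>UNIV. Q g $ i $ m * Q X $ m $ k))"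
        by (intro polynomial_fun_sum polynomial_fun.mult polynomial_fun.const polynomial)
      fix x assume x: "x \<in> G"
      have "Q (g ** x ** h) = Q g ** Q x ** Q h"
        using x gh subgroup_GL_facts(2)[OF subgroup] by (simp add: mult)
      then show "Q (g ** x ** h) $ i $ j =
          (\<Sum>k\<in>UNIV. Q h $ k $ j * (\<Sum>m\<in>UNIV. Q g $ i $ m * Q x $ m $ k))"
        by (simp add: matrix_matrix_mult_def mult.commute)
    qed
    also have "\<dots> = (\<Sum>k\<in>UNIV. Q h $ k $ j *
        (\<Sum>m\<in>UNIV. Q g $ i $ m * invariant_deriv A (\<lambda>X. Q X $ m $ k) (mat 1)))"
      by (simp add: invariant_deriv_sum invariant_deriv_cmult polynomial polynomial_fun.mult
          polynomial_fun.const polynomial_fun_sum)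
    finally show ?thesis by (simp add: matrix_matrix_mult_def matrix_deriv_def mult.commute)
  qed
  then show ?thesis by (simp add: vec_eq_iff matrix_deriv_def)
qed

end

section \<open>The differential of a rational representation\<close>

lemma represents_raise_denominator:
  assumes G: "subgroup G GL" and rep: "represents G f p k"
  shows "represents G f (\<lambda>X. p X * det X ^ m) (k + m)"
  using rep subgroup_GL_facts(3)[OF G]
  by (simp add: represents_def polynomial_fun.mult polynomial_fun_power polynomial_fun_det power_add)

text \<open>
  The quotient rule at the identity, where the determinant is \<open>1\<close>. Two representations
  \<open>p / det ^ k\<close> and \<open>p' / det ^ k'\<close> of \<open>f\<close> give the same value because \<open>p * det ^ k'\<close> and
  \<open>p' * det ^ k\<close> agree on \<open>G\<close>; hence the definite description in \<open>tangent_deriv\<close> is meaningful.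
\<close>

lemma tangent_deriv_represents:
  assumes G: "subgroup G GL" and rep: "represents G f p k" and A: "A \<in> lie_algebra_of G"
  shows "tangent_deriv G f A =
    invariant_deriv A p (mat 1) - of_nat k * f (mat 1) * invariant_deriv A det (mat 1)"
proof -
  let ?c = "invariant_deriv A det (mat 1)"
  let ?val = "\<lambda>p k. invariant_deriv A p (mat 1) - of_nat k * f (mat 1) * ?c"
  have deriv: "deriv (\<lambda>s. p (mat 1 + mscale s A) / det (mat 1 + mscale s A) ^ k) 0 = ?val p k"
    if "represents G f p k" for p k
  proof -
    have p: "polynomial_fun p" "f (mat 1) = p (mat 1)"
      using that subgroup_GL_facts(1)[OF G] by (auto simp: represents_def)
    have "((\<lambda>s. p (mat 1 + mscale s A) / det (mat 1 + mscale s A) ^ k) has_field_derivative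
        (invariant_deriv A p (mat 1) * det (mat 1 + mscale 0 A) ^ k
          - p (mat 1 + mscale 0 A) * (of_nat k * (?c * det (mat 1 + mscale 0 A) ^ (k - Suc 0))))
          / (det (mat 1 + mscale 0 A) ^ k * det (mat 1 + mscale 0 A) ^ k)) (at 0)"
      using has_invariant_deriv[OF p(1), of "mat 1" A] has_invariant_deriv[OF polynomial_fun_det, of "mat 1" A]
      by (intro DERIV_divide DERIV_power) simp_all
    then show ?thesis by (intro DERIV_imp_deriv) (simp add: p(2) mult_ac)
  qed
  have unique: "?val p' k' = ?val p k" if rep': "represents G f p' k'" for p' k'
  proof -
    have poly: "polynomial_fun p" "polynomial_fun p'" "f (mat 1) = p (mat 1)" "p' (mat 1) = p (mat 1)"
      using rep rep' subgroup_GL_facts(1)[OF G] by (auto simp: represents_def)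
    have power: "invariant_deriv A (\<lambda>X. det X ^ m) (mat 1) = of_nat m * ?c" for m
    proof (induction m)
      case (Suc m)
      then show ?case
        by (simp add: invariant_deriv_mult polynomial_fun_det polynomial_fun_power algebra_simps)
    qed (simp add: invariant_deriv_const)
    have "invariant_deriv A (\<lambda>X. p' X * det X ^ k) (mat 1) = invariant_deriv A (\<lambda>X. p X * det X ^ k') (mat 1)"
    proof (rule invariant_deriv_cong_on_group[OF G A])
      fix g assume "g \<in> G"
      then have "p' g / det g ^ k' = p g / det g ^ k" "det g \<noteq> 0"
        using rep rep' subgroup_GL_facts(3)[OF G] by (auto simp: represents_def)
      then show "p' g * det g ^ k = p g * det g ^ k'" by (simp add: field_simps)
    qed (intro polynomial_fun.mult polynomial_fun_power polynomial_fun_det poly)+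
    then show ?thesis
      by (simp add: invariant_deriv_mult polynomial_fun_det polynomial_fun_power poly power algebra_simps)
  qed
  show ?thesis
    unfolding tangent_deriv_def
  proof (rule the_equality)
    show "\<exists>p' k'. represents G f p' k' \<and>
        ?val p k = deriv (\<lambda>s. p' (mat 1 + mscale s A) / det (mat 1 + mscale s A) ^ k') 0"
      by (intro exI conjI) (rule rep, rule deriv[OF rep, symmetric])
  next
    fix D
    assume "\<exists>p' k'. represents G f p' k' \<and>
      D = deriv (\<lambda>s. p' (mat 1 + mscale s A) / det (mat 1 + mscale s A) ^ k') 0"
    then obtain p' k' where rep': "represents G f p' k'"
      and D: "D = deriv (\<lambda>s. p' (mat 1 + mscale s A) / det (mat 1 + mscale s A) ^ k') 0"
      by blast
    show "D = ?val p k" unfolding D deriv[OF rep'] by (rule unique[OF rep'])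
  qed
qed

locale rational_linear_representation =
  fixes G :: "(complex^'n^'n) set" and \<rho> :: "complex^'n^'n \<Rightarrow> complex^'m^'m"
  assumes subgroup: "subgroup G GL" and rational: "rational_representation G \<rho>"
begin

lemma rho_mult: "g \<in> G \<Longrightarrow> h \<in> G \<Longrightarrow> \<rho> (g ** h) = \<rho> g ** \<rho> h"
  using rational by (auto simp: rational_representation_def hom_def GL_def)

lemma rho_one: "\<rho> (mat 1) = mat 1"
proof -
  have one: "mat 1 \<in> G" using subgroup_GL_facts(1)[OF subgroup] .
  then have "invertible (\<rho> (mat 1))"
    using rational by (auto simp: rational_representation_def hom_def GL_def)
  then obtain R where R: "R ** \<rho> (mat 1) = mat 1" by (auto simp: invertible_def)
  have "R ** (\<rho> (mat 1) ** \<rho> (mat 1)) = R ** \<rho> (mat 1)" using rho_mult[OF one one] by simp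
  then show ?thesis by (simp add: matrix_mul_assoc R)
qed

text \<open>
  All entries are brought to a common denominator \<open>det ^ k\<close>. Since the determinant is
  multiplicative, \<open>det ^ k\<close> times \<open>\<rho>\<close> is still a homomorphism on \<open>G\<close>, and its entries are polynomials.
  Its differential differs from that of \<open>\<rho>\<close> by \<open>k\<close> times the derivative of the determinant, a scalar
  matrix that is linear in \<open>A\<close>, vanishes on brackets and is invariant under conjugation.
\<close>

lemma clear_denominators:
  obtains Q k where "polynomial_homomorphism G Q"
    and "\<And>g. g \<in> G \<Longrightarrow> Q g = mscale (det g ^ k) (\<rho> g)"
    and "\<And>A. A \<in> lie_algebra_of G \<Longrightarrow> differential G \<rho> A =
      matrix_deriv A Q (mat 1) - mscale (of_nat k * invariant_deriv A det (mat 1)) (mat 1)"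
proof -
  have "\<forall>i j. \<exists>p k. represents G (\<lambda>g. \<rho> g $ i $ j) p k"
    using rational by (simp add: rational_representation_def)
  then obtain p k0 where p: "\<And>i j. represents G (\<lambda>g. \<rho> g $ i $ j) (p i j) (k0 i j)" by metis
  define k where "k = (\<Sum>i\<in>UNIV. \<Sum>j\<in>UNIV. k0 i j)"
  have k: "k0 i j \<le> k" for i j
  proof -
    have "k0 i j \<le> (\<Sum>j\<in>UNIV. k0 i j)" by (rule member_le_sum) auto
    also have "\<dots> \<le> k"
      unfolding k_def by (rule member_le_sum[of i UNIV "\<lambda>i. \<Sum>j\<in>UNIV. k0 i j"]) auto
    finally show ?thesis .
  qed
  define Q where "Q X = (\<chi> i j. p i j X * det X ^ (k - k0 i j))" for X
  have rep: "represents G (\<lambda>g. \<rho> g $ i $ j) (\<lambda>X. Q X $ i $ j) k" for i j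
    using represents_raise_denominator[OF subgroup p[of i j], of "k - k0 i j"] k[of i j]
    by (simp add: Q_def)
  show thesis
  proof
    show Q: "Q g = mscale (det g ^ k) (\<rho> g)" if "g \<in> G" for g
      using rep that subgroup_GL_facts(3)[OF subgroup that] by (simp add: vec_eq_iff represents_def)
    show "polynomial_homomorphism G Q"
    proof (rule polynomial_homomorphism.intro)
      show "polynomial_fun (\<lambda>X. Q X $ i $ j)" for i j
        using rep by (simp add: represents_def)
    qed (simp_all add: subgroup Q subgroup_GL_facts(2)[OF subgroup] rho_mult det_mul
        power_mult_distrib mscale_mult_left mscale_mult_right mult.commute)
    show "differential G \<rho> A =
        matrix_deriv A Q (mat 1) - mscale (of_nat k * invariant_deriv A det (mat 1)) (mat 1)"
      if "A \<in> lie_algebra_of G" for A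
      using tangent_deriv_represents[OF subgroup rep that]
      by (simp add: vec_eq_iff differential_def matrix_deriv_def rho_one)
  qed
qed

lemma differential_add:
  assumes "A \<in> lie_algebra_of G" "B \<in> lie_algebra_of G"
  shows "differential G \<rho> (A + B) = differential G \<rho> A + differential G \<rho> B"
proof -
  obtain Q k where "polynomial_homomorphism G Q"
    and "\<And>g. g \<in> G \<Longrightarrow> Q g = mscale (det g ^ k) (\<rho> g)"
    and d: "\<And>A. A \<in> lie_algebra_of G \<Longrightarrow> differential G \<rho> A =
      matrix_deriv A Q (mat 1) - mscale (of_nat k * invariant_deriv A det (mat 1)) (mat 1)"
    by (rule clear_denominators) (rule that)
  interpret polynomial_homomorphism G Q by fact
  have "A + B \<in> lie_algebra_of G" using assms mat_vs.subspace_add[OF subspace_lie_algebra_of] by blast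
  then show ?thesis
    using assms by (simp add: d matrix_deriv_add invariant_deriv_direction_add[OF polynomial_fun_det]
        distrib_left mat_vs.scale_left_distrib)
qed

lemma differential_scale:
  assumes "A \<in> lie_algebra_of G"
  shows "differential G \<rho> (mscale c A) = mscale c (differential G \<rho> A)"
proof -
  obtain Q k where "polynomial_homomorphism G Q"
    and "\<And>g. g \<in> G \<Longrightarrow> Q g = mscale (det g ^ k) (\<rho> g)"
    and d: "\<And>A. A \<in> lie_algebra_of G \<Longrightarrow> differential G \<rho> A =
      matrix_deriv A Q (mat 1) - mscale (of_nat k * invariant_deriv A det (mat 1)) (mat 1)"
    by (rule clear_denominators) (rule that)
  interpret polynomial_homomorphism G Q by fact
  have "mscale c A \<in> lie_algebra_of G" using assms mat_vs.subspace_scale[OF subspace_lie_algebra_of] by blast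
  then show ?thesis
    using assms by (simp add: d matrix_deriv_scale invariant_deriv_direction_scale[OF polynomial_fun_det]
        mat_vs.scale_right_diff_distrib mult.left_commute)
qed

lemma differential_bracket:
  assumes "A \<in> lie_algebra_of G" "B \<in> lie_algebra_of G"
  shows "differential G \<rho> (lie_bracket A B) = lie_bracket (differential G \<rho> A) (differential G \<rho> B)"
proof -
  obtain Q k where "polynomial_homomorphism G Q"
    and "\<And>g. g \<in> G \<Longrightarrow> Q g = mscale (det g ^ k) (\<rho> g)"
    and d: "\<And>A. A \<in> lie_algebra_of G \<Longrightarrow> differential G \<rho> A =
      matrix_deriv A Q (mat 1) - mscale (of_nat k * invariant_deriv A det (mat 1)) (mat 1)"
    by (rule clear_denominators) (rule that)
  interpret polynomial_homomorphism G Q by fact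
  \<comment> \<open>Scalar matrices are central, so the correction terms drop out of the bracket.\<close>
  have central: "lie_bracket (M - mscale a (mat 1)) (N - mscale b (mat 1)) = lie_bracket M N"
    for M N :: "complex^'m^'m" and a b
    by (simp add: lie_bracket_def matrix_mult_diff_left matrix_mult_diff_right mscale_mult_left
        mscale_mult_right mult.commute algebra_simps)
  show ?thesis
    using assms lie_bracket_in_lie_algebra_of[OF subgroup assms]
    by (simp add: d central matrix_deriv_bracket invariant_deriv_det_bracket)
qed

lemma differential_conjugate:
  assumes A: "A \<in> lie_algebra_of G" and gh: "g \<in> G" "h \<in> G" "g ** h = mat 1"
  shows "differential G \<rho> (g ** A ** h) = \<rho> g ** differential G \<rho> A ** \<rho> h"
proof -
  obtain Q k where "polynomial_homomorphism G Q"
    and Q: "\<And>g. g \<in> G \<Longrightarrow> Q g = mscale (det g ^ k) (\<rho> g)"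
    and d: "\<And>A. A \<in> lie_algebra_of G \<Longrightarrow> differential G \<rho> A =
      matrix_deriv A Q (mat 1) - mscale (of_nat k * invariant_deriv A det (mat 1)) (mat 1)"
    by (rule clear_denominators) (rule that)
  interpret polynomial_homomorphism G Q by fact
  have "det g * det h = 1" using gh(3) by (metis det_I det_mul)
  then have det: "det g ^ k * det h ^ k = 1" by (simp flip: power_mult_distrib)
  have one: "\<rho> g ** \<rho> h = mat 1" using rho_mult[OF gh(1,2)] gh(3) rho_one by simp
  have "Q g ** M ** Q h = \<rho> g ** M ** \<rho> h" for M
    using det by (simp add: Q gh mscale_mult_left mscale_mult_right mult.commute)
  then show ?thesis
    using A conjugate_in_lie_algebra_of[OF subgroup A gh] one
    by (simp add: d matrix_deriv_conjugate[OF A gh] invariant_deriv_det_conjugate[OF gh(3)]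
        matrix_mult_diff_left matrix_mult_diff_right mscale_mult_left mscale_mult_right)
qed

end

section \<open>The adjoint grading of a one-parameter subgroup\<close>

text \<open>
  All matrices are graded by the weights of conjugation with \<open>l t\<close>. Grading the full matrix
  space keeps the projections linear and total; that they restrict to \<open>Lie(G)\<close> is
  \<open>component_in_lie_algebra\<close>.
\<close>

locale adjoint_grading = graded_vector_space "mscale :: complex \<Rightarrow> complex^'n^'n \<Rightarrow> complex^'n^'n" S P
  for S and P :: "int \<Rightarrow> complex^'n^'n \<Rightarrow> complex^'n^'n" +
  fixes G :: "(complex^'n^'n) set" and l :: "complex \<Rightarrow> complex^'n^'n"
  assumes subgroup: "subgroup G GL"
    and l_in_group: "t \<noteq> 0 \<Longrightarrow> l t \<in> G" "t \<noteq> 0 \<Longrightarrow> matrix_inv (l t) \<in> G"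
    and l_inverse: "t \<noteq> 0 \<Longrightarrow> l t ** matrix_inv (l t) = mat 1"
      "t \<noteq> 0 \<Longrightarrow> matrix_inv (l t) ** l t = mat 1"
    and adjoint: "t \<noteq> 0 \<Longrightarrow>
      l t ** A ** matrix_inv (l t) = (\<Sum>j\<in>S. mscale (t powi j) (P j A))"
begin

lemma adjoint_component:
  assumes "t \<noteq> 0"
  shows "l t ** P j A ** matrix_inv (l t) = mscale (t powi j) (P j A)"
proof -
  have "l t ** P j A ** matrix_inv (l t) = (\<Sum>i\<in>S. if i = j then mscale (t powi j) (P j A) else 0)"
    by (simp only: adjoint[OF assms] component_component) (intro sum.cong, auto)
  then show ?thesis using component_outside[of j A] by (simp add: finite_degrees)
qed

lemma component_homogeneous:
  assumes hom: "\<And>t. t \<noteq> 0 \<Longrightarrow> l t ** A ** matrix_inv (l t) = mscale (t powi j) A"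
  shows "P i A = (if i = j then A else 0)"
proof -
  \<comment> \<open>Both degrees are adjoined because neither needs to lie in \<open>S\<close>.\<close>
  let ?S = "insert i (insert j S)"
  have fin: "finite ?S" using finite_degrees by simp
  show ?thesis
  proof (rule laurent_matrix_unique[OF fin, where a = "\<lambda>m. P m A" and b = "\<lambda>m. if m = j then A else 0"])
    fix t :: complex assume t: "t \<noteq> 0"
    have "(\<Sum>m\<in>?S. mscale (t powi m) (P m A)) = (\<Sum>m\<in>S. mscale (t powi m) (P m A))"
      using component_outside by (intro sum.mono_neutral_right fin) auto
    also have "\<dots> = mscale (t powi j) A" using adjoint[OF t] hom[OF t] by simp
    also have "\<dots> = (\<Sum>m\<in>?S. if m = j then mscale (t powi j) A else 0)"
      using fin by (subst sum.delta) auto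
    also have "\<dots> = (\<Sum>m\<in>?S. mscale (t powi m) (if m = j then A else 0))"
      by (intro sum.cong) auto
    finally show "(\<Sum>m\<in>?S. mscale (t powi m) (P m A)) =
        (\<Sum>m\<in>?S. mscale (t powi m) (if m = j then A else 0))" .
  qed simp
qed

text \<open>
  \<open>Lie(G)\<close> is the common kernel of linear functionals \<open>\<phi>\<close> and is stable under conjugation. So the
  Laurent polynomial \<open>\<phi> (l t ** A ** matrix_inv (l t))\<close> vanishes identically, and its coefficients are the
  values of \<open>\<phi>\<close> on the components of \<open>A\<close>.
\<close>

lemma component_in_lie_algebra:
  assumes A: "A \<in> lie_algebra_of G"
  shows "P j A \<in> lie_algebra_of G"
  unfolding lie_algebra_of_iff
proof (intro allI impI)
  fix p assume p: "polynomial_fun p" "\<forall>g\<in>G. p g = 0"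
  let ?\<phi> = "\<lambda>B. invariant_deriv B p (mat 1)"
  have sum: "?\<phi> (\<Sum>i\<in>I. f i) = (\<Sum>i\<in>I. ?\<phi> (f i))" for I and f :: "int \<Rightarrow> complex^'n^'n"
    using invariant_deriv_direction_scale[OF p(1), of 0]
    by (induction I rule: infinite_finite_induct) (simp_all add: invariant_deriv_direction_add[OF p(1)])
  have "(\<Sum>i\<in>S. t powi i * ?\<phi> (P i A)) = 0" if t: "t \<noteq> 0" for t
  proof -
    have "l t ** A ** matrix_inv (l t) \<in> lie_algebra_of G"
      using l_in_group[OF t] l_inverse[OF t] by (intro conjugate_in_lie_algebra_of[OF subgroup A])
    then have "?\<phi> (\<Sum>i\<in>S. mscale (t powi i) (P i A)) = 0"
      using p by (simp add: adjoint[OF t] lie_algebra_of_iff)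
    then show ?thesis by (simp add: sum invariant_deriv_direction_scale[OF p(1)])
  qed
  then have "(\<Sum>i | i \<in> S \<and> i = j. ?\<phi> (P i A)) = 0"
    by (rule laurent_coefficients_zero[OF finite_degrees])
  moreover have "{i. i \<in> S \<and> i = j} = (if j \<in> S then {j} else {})" by auto
  moreover have "?\<phi> 0 = 0" using sum[of "\<lambda>_. 0" "{}"] by simp
  ultimately show "?\<phi> (P j A) = 0" using component_outside[of j A] by (auto split: if_splits)
qed

lemma component_in_weight_space:
  "A \<in> lie_algebra_of G \<Longrightarrow> P j A \<in> lie_weight_space G l j"
  by (simp add: lie_weight_space_def component_in_lie_algebra adjoint_component)

lemma weight_space_component: "lie_weight_space G l j \<subseteq> {A. P j A = A}"
proof
  fix A assume "A \<in> lie_weight_space G l j"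
  then have "P j A = (if j = j then A else 0)"
    by (intro component_homogeneous) (simp add: lie_weight_space_def)
  then show "A \<in> {A. P j A = A}" by simp
qed

lemma leading_term_lie:
  "A \<in> lie_algebra_of G \<Longrightarrow> leading_term (lie_weight_space G l) A = lead A"
  by (intro leading_term_eq_lead weight_space_component component_in_weight_space)

lemma component_bracket:
  "P m (lie_bracket A B) = (\<Sum>i\<in>S. \<Sum>j\<in>S. if m = i + j then lie_bracket (P i A) (P j B) else 0)"
proof -
  have hom: "P m (lie_bracket (P i A) (P j B)) = (if m = i + j then lie_bracket (P i A) (P j B) else 0)" for i j
  proof (rule component_homogeneous)
    fix t :: complex assume t: "t \<noteq> 0"
    have conj: "l t ** (X ** Y) ** matrix_inv (l t) =
        (l t ** X ** matrix_inv (l t)) ** (l t ** Y ** matrix_inv (l t))" for X Y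
    proof -
      have "(l t ** X ** matrix_inv (l t)) ** (l t ** Y ** matrix_inv (l t)) =
          l t ** X ** (matrix_inv (l t) ** l t) ** Y ** matrix_inv (l t)"
        by (simp only: matrix_mul_assoc)
      then show ?thesis by (simp add: l_inverse(2)[OF t] matrix_mul_assoc)
    qed
    show "l t ** lie_bracket (P i A) (P j B) ** matrix_inv (l t) =
        mscale (t powi (i + j)) (lie_bracket (P i A) (P j B))"
      using t by (simp add: lie_bracket_def matrix_mult_diff_left matrix_mult_diff_right conj
          adjoint_component mscale_mult_left mscale_mult_right power_int_add
          mat_vs.scale_right_diff_distrib mult.commute)
  qed
  have bracket_sum: "lie_bracket (\<Sum>i\<in>S. X i) (\<Sum>j\<in>S. Y j) = (\<Sum>i\<in>S. \<Sum>j\<in>S. lie_bracket (X i) (Y j))"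
    for X Y :: "int \<Rightarrow> complex^'n^'n"
  proof -
    have "(\<Sum>j\<in>S. Y j) ** (\<Sum>i\<in>S. X i) = (\<Sum>i\<in>S. \<Sum>j\<in>S. Y j ** X i)"
      by (simp add: matrix_mult_sum_left matrix_mult_sum_right)
    then show ?thesis
      by (simp add: lie_bracket_def sum_subtractf matrix_mult_sum_left matrix_mult_sum_right) (rule sum.swap)
  qed
  have "P m (lie_bracket A B) = P m (lie_bracket (\<Sum>i\<in>S. P i A) (\<Sum>j\<in>S. P j B))"
    by (simp only: sum_components)
  then show ?thesis by (simp add: bracket_sum component_sum hom)
qed

text \<open>
  The components of the bracket below degree \<open>a + b\<close> vanish, and in degree \<open>a + b\<close> only the two lowest
  components contribute.
\<close>

lemma lead_bracket:
  assumes A: "lead A = P a A" "\<And>i. i < a \<Longrightarrow> P i A = 0" "a \<in> S"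
    and B: "lead B = P b B" "\<And>i. i < b \<Longrightarrow> P i B = 0" "b \<in> S"
    and nz: "lie_bracket (lead A) (lead B) \<noteq> 0"
  shows "lead (lie_bracket A B) = lie_bracket (lead A) (lead B)"
proof -
  have zero: "lie_bracket 0 X = 0" "lie_bracket X 0 = 0" for X :: "complex^'n^'n"
    by (simp_all add: lie_bracket_def vec_eq_iff matrix_matrix_mult_def)
  have low: "P m (lie_bracket A B) = (if m = a + b then lie_bracket (P a A) (P b B) else 0)"
    if "m \<le> a + b" for m
  proof -
    have "P m (lie_bracket A B) = (\<Sum>i\<in>S. \<Sum>j\<in>S. if j = b then
        (if i = a then (if m = a + b then lie_bracket (P a A) (P b B) else 0) else 0) else 0)"
      unfolding component_bracket
    proof (intro sum.cong refl)
      fix i j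
      show "(if m = i + j then lie_bracket (P i A) (P j B) else 0) = (if j = b then
        (if i = a then (if m = a + b then lie_bracket (P a A) (P b B) else 0) else 0) else 0)"
        using A(2)[of i] B(2)[of j] that by (cases "i < a"; cases "j < b") (auto simp: zero)
    qed
    then show ?thesis using A(3) B(3) by (simp add: finite_degrees)
  qed
  have "lead (lie_bracket A B) = P (a + b) (lie_bracket A B)"
    using nz by (intro lead_eqI) (auto simp: low A(1) B(1))
  then show ?thesis by (simp add: low A(1) B(1))
qed

end

lemma one_parameter_subgroup_facts:
  assumes G: "subgroup G GL" and l: "one_parameter_subgroup G l" and t: "t \<noteq> 0"
  shows "l t \<in> G" and "matrix_inv (l t) = l (inverse t)"
    and "l t ** l (inverse t) = mat 1" and "l (inverse t) ** l t = mat 1"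
proof -
  have mem: "l s \<in> G" if "s \<noteq> 0" for s
    using l that by (auto simp: one_parameter_subgroup_def hom_def Gm_def)
  have mult: "l (s * u) = l s ** l u" if "s \<noteq> 0" "u \<noteq> 0" for s u
    using l that by (auto simp: one_parameter_subgroup_def hom_def Gm_def GL_def)
  have "invertible (l 1)" using subgroup_GL_facts(3)[OF G mem[of 1]] by (simp add: invertible_det_nz)
  then obtain R where R: "R ** l 1 = mat 1" by (auto simp: invertible_def)
  have "R ** (l 1 ** l 1) = R ** l 1" using mult[of 1 1] by simp
  then have one: "l 1 = mat 1" by (simp add: matrix_mul_assoc R)
  show "l t \<in> G" using mem t .
  show lr: "l t ** l (inverse t) = mat 1" and rl: "l (inverse t) ** l t = mat 1"
    using mult[of t "inverse t"] mult[of "inverse t" t] t by (simp_all add: one)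
  have "\<exists>B. l t ** B = mat 1 \<and> B ** l t = mat 1" using lr rl by blast
  then have inv: "l t ** matrix_inv (l t) = mat 1"
    unfolding matrix_inv_def by (rule someI2_ex) simp
  have "matrix_inv (l t) = l (inverse t) ** l t ** matrix_inv (l t)" by (simp add: rl)
  also have "\<dots> = l (inverse t)" by (simp add: inv flip: matrix_mul_assoc)
  finally show "matrix_inv (l t) = l (inverse t)" .
qed

text \<open>
  The entries are Laurent polynomials with their own ranges of exponents; one symmetric range serves
  for all of them.
\<close>

lemma one_parameter_subgroup_laurent:
  assumes "one_parameter_subgroup G l"
  obtains C :: "int \<Rightarrow> complex^'n^'n" and K where
    "\<And>t. t \<noteq> 0 \<Longrightarrow> l t = (\<Sum>i\<in>{- int K..int K}. mscale (t powi i) (C i))"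
proof -
  have "\<exists>a N. \<forall>K t. N \<le> K \<longrightarrow> t \<noteq> 0 \<longrightarrow> l t $ i $ j = (\<Sum>m\<in>{- int K..int K}. t powi m * a m)" for i j
  proof -
    obtain p k where pk: "\<And>t. t \<noteq> 0 \<Longrightarrow> l t $ i $ j = poly p t / t ^ k"
      using assms unfolding one_parameter_subgroup_def by meson
    obtain a N where "\<And>K t. N \<le> K \<Longrightarrow> t \<noteq> 0 \<Longrightarrow>
        poly p t / t ^ k = (\<Sum>i\<in>{- int K..int K}. t powi i * a i)"
      by (rule laurent_expansion[where p = p and k = k]) (rule that)
    then show ?thesis using pk by auto
  qed
  then obtain a N where a: "\<And>i j K t. N i j \<le> K \<Longrightarrow> t \<noteq> 0 \<Longrightarrow>
      l t $ i $ j = (\<Sum>m\<in>{- int K..int K}. t powi m * a i j m)"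
    by metis
  define K where "K = (\<Sum>i\<in>UNIV. \<Sum>j\<in>UNIV. N i j)"
  have "N i j \<le> K" for i j
  proof -
    have "N i j \<le> (\<Sum>j\<in>UNIV. N i j)" by (rule member_le_sum) auto
    also have "\<dots> \<le> K"
      unfolding K_def by (rule member_le_sum[of i UNIV "\<lambda>i. \<Sum>j\<in>UNIV. N i j"]) auto
    finally show ?thesis .
  qed
  then have "l t = (\<Sum>m\<in>{- int K..int K}. mscale (t powi m) (\<chi> i j. a i j m))" if "t \<noteq> 0" for t
    using a that by (simp add: vec_eq_iff)
  then show thesis by (rule that)
qed

text \<open>
  With \<open>l t = (\<Sum>i. mscale (t powi i) (C i))\<close> the conjugate of \<open>A\<close> is the sum of
  \<open>mscale (t powi (i - i')) (C i ** A ** C i')\<close>, and \<open>P j A\<close> collects the terms with \<open>i - i' = j\<close>. That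
  these maps are complementary projections follows from \<open>l (s * t) = l s ** l t\<close> by comparing Laurent
  coefficients.
\<close>

lemma adjoint_grading_exists:
  assumes G: "subgroup G GL" and l: "one_parameter_subgroup G l"
  obtains S P where "adjoint_grading S P G l"
proof -
  note facts = one_parameter_subgroup_facts[OF G l]
  obtain C K where C: "\<And>t. t \<noteq> 0 \<Longrightarrow> l t = (\<Sum>i\<in>{- int K..int K}. mscale (t powi i) (C i))"
    by (rule one_parameter_subgroup_laurent[OF l]) (rule that)
  define I where "I = {- int K..int K} \<times> {- int K..int K}"
  define S where "S = (\<lambda>x. fst x - snd x) ` I"
  define P where "P j A = (\<Sum>x | x \<in> I \<and> fst x - snd x = j. C (fst x) ** A ** C (snd x))" for j A
  have fin: "finite I" "finite S" by (simp_all add: I_def S_def)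
  have ad: "l t ** A ** l (inverse t) = (\<Sum>j\<in>S. mscale (t powi j) (P j A))" if t: "t \<noteq> 0" for t A
  proof -
    have "l t ** A ** l (inverse t) = (\<Sum>x\<in>I. mscale (t powi fst x) (C (fst x)) ** A **
        mscale (inverse t powi snd x) (C (snd x)))"
      unfolding I_def using t
      by (simp add: C matrix_mult_sum_left) (simp add: matrix_mult_sum_right sum.cartesian_product split_def)
    also have "\<dots> = (\<Sum>x\<in>I. mscale (t powi (fst x - snd x)) (C (fst x) ** A ** C (snd x)))"
      using t by (intro sum.cong) (simp_all add: mscale_mult_left mscale_mult_right power_int_diff
          power_int_inverse field_simps)
    also have "\<dots> = (\<Sum>j\<in>S. \<Sum>x | x \<in> I \<and> fst x - snd x = j.
        mscale (t powi (fst x - snd x)) (C (fst x) ** A ** C (snd x)))"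
      using fin by (intro sum.group[symmetric]) (auto simp: S_def)
    also have "\<dots> = (\<Sum>j\<in>S. mscale (t powi j) (P j A))"
      unfolding P_def mat_vs.scale_sum_right by (intro sum.cong) auto
    finally show ?thesis .
  qed
  have outside: "P j A = 0" if "j \<notin> S" for j A
  proof -
    have "{x. x \<in> I \<and> fst x - snd x = j} = {}" using that by (auto simp: S_def image_iff)
    then show ?thesis unfolding P_def by (simp only: sum.empty)
  qed
  have lin: "Vector_Spaces.linear mscale mscale (P j)" for j
    unfolding Vector_Spaces.linear_iff
    by (intro conjI mat_vs.vector_space_axioms allI)
       (simp_all add: P_def matrix_add_ldistrib matrix_mult_add_left sum.distrib mscale_mult_left
          mscale_mult_right mat_vs.scale_sum_right)
  have mult: "l (s * t) = l s ** l t" if "s \<noteq> 0" "t \<noteq> 0" for s t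
    using l that by (auto simp: one_parameter_subgroup_def hom_def Gm_def GL_def)
  have one: "l 1 = mat 1" using facts(3)[of 1] mult[of 1 1] by simp
  have sum: "(\<Sum>j\<in>S. P j A) = A" for A using ad[of 1 A] one by simp
  have ad_component: "l s ** P j A ** l (inverse s) = mscale (s powi j) (P j A)" if s: "s \<noteq> 0" for s j A
  proof (cases "j \<in> S")
    case True
    show ?thesis
    proof (rule laurent_matrix_unique[OF fin(2) True])
      fix t :: complex assume t: "t \<noteq> 0"
      have "(\<Sum>i\<in>S. mscale (t powi i) (l s ** P i A ** l (inverse s))) =
          l s ** (\<Sum>i\<in>S. mscale (t powi i) (P i A)) ** l (inverse s)"
        by (simp add: matrix_mult_sum_left matrix_mult_sum_right mscale_mult_left mscale_mult_right)
      also have "\<dots> = l (s * t) ** A ** l (inverse (s * t))"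
        using s t by (simp add: ad[OF t, symmetric] mult mult.commute[of "inverse s"] matrix_mul_assoc)
      also have "\<dots> = (\<Sum>i\<in>S. mscale (t powi i) (mscale (s powi i) (P i A)))"
        using s t by (subst ad) (simp_all add: power_int_mult_distrib mult.commute)
      finally show "(\<Sum>i\<in>S. mscale (t powi i) (l s ** P i A ** l (inverse s))) =
          (\<Sum>i\<in>S. mscale (t powi i) (mscale (s powi i) (P i A)))" .
    qed
  next
    case False
    then show ?thesis by (simp add: outside vec_eq_iff matrix_matrix_mult_def)
  qed
  have comp: "P i (P j A) = (if i = j then P j A else 0)" for i j A
  proof (cases "i \<in> S")
    case True
    show ?thesis
    proof (rule laurent_matrix_unique[OF fin(2) True])
      fix t :: complex assume t: "t \<noteq> 0"
      have "(\<Sum>i\<in>S. mscale (t powi i) (P i (P j A))) = mscale (t powi j) (P j A)"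
        using ad[OF t, of "P j A"] ad_component[OF t] by simp
      also have "\<dots> = (\<Sum>i\<in>S. if i = j then mscale (t powi j) (P j A) else 0)"
        using outside[of j A] fin(2) by simp
      also have "\<dots> = (\<Sum>i\<in>S. mscale (t powi i) (if i = j then P j A else 0))"
        by (intro sum.cong) auto
      finally show "(\<Sum>i\<in>S. mscale (t powi i) (P i (P j A))) =
          (\<Sum>i\<in>S. mscale (t powi i) (if i = j then P j A else 0))" .
    qed
  next
    case False
    then show ?thesis by (auto simp: outside)
  qed
  have "adjoint_grading S P G l"
    by (intro adjoint_grading.intro graded_vector_space.intro graded_vector_space_axioms.intro
        adjoint_grading_axioms.intro mat_vs.vector_space_axioms)
       (use fin(2) lin outside sum comp G facts ad in simp_all)
  then show thesis by (rule that)
qed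

section \<open>Leading terms of a stabilizer\<close>

context rational_linear_representation
begin

lemma differential_zero: "differential G \<rho> 0 = 0"
  using differential_scale[of 0 0] mat_vs.subspace_0[OF subspace_lie_algebra_of[of G]] by simp

lemma differential_sum:
  "(\<And>x. x \<in> I \<Longrightarrow> f x \<in> lie_algebra_of G) \<Longrightarrow>
    differential G \<rho> (\<Sum>x\<in>I. f x) = (\<Sum>x\<in>I. differential G \<rho> (f x))"
  by (induction I rule: infinite_finite_induct)
     (simp_all add: differential_zero differential_add mat_vs.subspace_sum subspace_lie_algebra_of)

lemma subspace_lie_stabilizer: "mat_vs.subspace (lie_stabilizer G \<rho> v)"
  using subspace_lie_algebra_of[of G]
  by (auto simp: mat_vs.subspace_def lie_stabilizer_def differential_zero differential_add
      differential_scale mscale_mult_vector matrix_vector_mult_add_rdistrib)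

lemma bracket_in_lie_stabilizer:
  assumes "A \<in> lie_stabilizer G \<rho> v" "B \<in> lie_stabilizer G \<rho> v"
  shows "lie_bracket A B \<in> lie_stabilizer G \<rho> v"
  using assms lie_bracket_in_lie_algebra_of[OF subgroup, of A B]
  by (simp add: lie_stabilizer_def differential_bracket)
     (simp add: lie_bracket_def matrix_vector_mult_diff_rdistrib flip: matrix_vector_mul_assoc)

lemma matrix_lie_algebra_lie_stabilizer: "matrix_lie_algebra (lie_stabilizer G \<rho> v)"
  by (simp add: matrix_lie_algebra_def subspace_lie_stabilizer bracket_in_lie_stabilizer)

lemma subspace_normal_stabilizer: "mat_vs.subspace (normal_stabilizer G \<rho> z v)"
proof (rule mat_vs.subspaceI)
  have L: "A \<in> lie_algebra_of G" if "A \<in> normal_stabilizer G \<rho> z v" for A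
    using that by (simp add: normal_stabilizer_def lie_stabilizer_def)
  note S = subspace_lie_stabilizer[of z]
  note V = subspace_lie_algebra_of[of G]
  have zero: "0 \<in> orbit_tangent_space G \<rho> z"
    using mat_vs.subspace_0[OF V] differential_zero
    unfolding orbit_tangent_space_def by force
  then show "0 \<in> normal_stabilizer G \<rho> z v"
    using mat_vs.subspace_0[OF S] by (simp add: normal_stabilizer_def differential_zero)
  fix A B assume AB: "A \<in> normal_stabilizer G \<rho> z v" "B \<in> normal_stabilizer G \<rho> z v"
  then obtain A' B' where *: "A' \<in> lie_algebra_of G" "differential G \<rho> A *v v = differential G \<rho> A' *v z"
    "B' \<in> lie_algebra_of G" "differential G \<rho> B *v v = differential G \<rho> B' *v z"
    by (auto simp: normal_stabilizer_def orbit_tangent_space_def)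
  have "differential G \<rho> (A + B) *v v = differential G \<rho> (A' + B') *v z"
    using * L[OF AB(1)] L[OF AB(2)] by (simp add: differential_add matrix_vector_mult_add_rdistrib)
  moreover have "A' + B' \<in> lie_algebra_of G" using * mat_vs.subspace_add[OF V] by blast
  ultimately show "A + B \<in> normal_stabilizer G \<rho> z v"
    using AB mat_vs.subspace_add[OF S] unfolding normal_stabilizer_def orbit_tangent_space_def by blast
next
  fix c A assume A: "A \<in> normal_stabilizer G \<rho> z v"
  note S = subspace_lie_stabilizer[of z]
  note V = subspace_lie_algebra_of[of G]
  have L: "A \<in> lie_algebra_of G" using A by (simp add: normal_stabilizer_def lie_stabilizer_def)
  obtain A' where *: "A' \<in> lie_algebra_of G" "differential G \<rho> A *v v = differential G \<rho> A' *v z"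
    using A by (auto simp: normal_stabilizer_def orbit_tangent_space_def)
  have "differential G \<rho> (mscale c A) *v v = differential G \<rho> (mscale c A') *v z"
    using * L by (simp add: differential_scale mscale_mult_vector)
  moreover have "mscale c A' \<in> lie_algebra_of G" using * mat_vs.subspace_scale[OF V] by blast
  ultimately show "mscale c A \<in> normal_stabilizer G \<rho> z v"
    using A mat_vs.subspace_scale[OF S] unfolding normal_stabilizer_def orbit_tangent_space_def by blast
qed

end

locale graded_representation = adjoint_grading S P G l + rational_linear_representation G \<rho>
  for S P and G :: "(complex^'n^'n) set" and l and \<rho> :: "complex^'n^'n \<Rightarrow> complex^'m^'m"
begin

text \<open>
  Conjugating \<open>k\<close> by \<open>l t\<close> gives a matrix that annihilates \<open>\<rho> (l t) *v y\<close>. Expanding both factors yields a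
  Laurent polynomial in \<open>t\<close> that vanishes identically; the claim is its coefficient of degree \<open>m\<close>.
\<close>

lemma weighted_stabilizer_equation:
  assumes T: "finite T" "\<And>i. i \<notin> T \<Longrightarrow> v i = 0"
    and y: "\<And>t. t \<noteq> 0 \<Longrightarrow> \<rho> (l t) *v y = (\<Sum>i\<in>T. (t powi i) *s v i)"
    and k: "k \<in> lie_stabilizer G \<rho> y"
  shows "(\<Sum>j\<in>S. differential G \<rho> (P j k) *v v (m - j)) = 0"
proof -
  let ?d = "differential G \<rho>"
  have kL: "k \<in> lie_algebra_of G" "?d k *v y = 0" using k by (simp_all add: lie_stabilizer_def)
  have vanish: "(\<Sum>x\<in>S \<times> T. (t powi (fst x + snd x)) *s (?d (P (fst x) k) *v v (snd x))) = 0"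
    if t: "t \<noteq> 0" for t
  proof -
    note lt = l_in_group[OF t] l_inverse[OF t]
    have "\<rho> (matrix_inv (l t)) ** \<rho> (l t) = mat 1"
      using rho_mult[OF lt(2,1)] lt(4) rho_one by simp
    moreover have "?d (l t ** k ** matrix_inv (l t)) *v (\<rho> (l t) *v y) =
        \<rho> (l t) *v (?d k *v ((\<rho> (matrix_inv (l t)) ** \<rho> (l t)) *v y))"
      by (simp only: differential_conjugate[OF kL(1) lt(1-3)] matrix_vector_mul_assoc matrix_mul_assoc)
    ultimately have "?d (l t ** k ** matrix_inv (l t)) *v (\<rho> (l t) *v y) = \<rho> (l t) *v (?d k *v y)"
      by simp
    also have "\<dots> = 0" using kL by simp
    finally have "0 = ?d (\<Sum>j\<in>S. mscale (t powi j) (P j k)) *v (\<Sum>i\<in>T. (t powi i) *s v i)"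
      by (simp add: adjoint[OF t] y[OF t])
    also have "?d (\<Sum>j\<in>S. mscale (t powi j) (P j k)) = (\<Sum>j\<in>S. mscale (t powi j) (?d (P j k)))"
      using component_in_lie_algebra[OF kL(1)] mat_vs.subspace_scale[OF subspace_lie_algebra_of[of G]]
      by (simp add: differential_sum differential_scale)
    also have "(\<Sum>j\<in>S. mscale (t powi j) (?d (P j k))) *v (\<Sum>i\<in>T. (t powi i) *s v i)
        = (\<Sum>j\<in>S. \<Sum>i\<in>T. (t powi (j + i)) *s (?d (P j k) *v v i))"
    proof -
      have left: "(\<Sum>j\<in>J. M j) *v u = (\<Sum>j\<in>J. M j *v u)" for J :: "int set" and M :: "int \<Rightarrow> complex^'m^'m" and u
        by (induction J rule: infinite_finite_induct) (simp_all add: matrix_vector_mult_add_rdistrib)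
      have right: "M *v (\<Sum>j\<in>J. u j) = (\<Sum>j\<in>J. M *v u j)" for J :: "int set" and M :: "complex^'m^'m" and u
        by (induction J rule: infinite_finite_induct) (simp_all add: matrix_vector_right_distrib)
      show ?thesis
        unfolding left unfolding right using t
        by (intro sum.cong refl) (simp add: mscale_mult_vector vector_scalar_commute vector_smult_assoc power_int_add mult.commute)
    qed
    finally show ?thesis by (simp add: sum.cartesian_product split_def)
  qed
  have "0 = (\<Sum>x | x \<in> S \<times> T \<and> fst x + snd x = m. ?d (P (fst x) k) *v v (snd x))"
    using finite_degrees T(1) vanish by (intro laurent_vector_coefficients_zero[symmetric]) auto
  also have "\<dots> = (\<Sum>x\<in>S \<times> T. if fst x + snd x = m then ?d (P (fst x) k) *v v (snd x) else 0)"
    using finite_degrees T(1) by (simp add: sum.If_cases Int_def)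
  also have "\<dots> = (\<Sum>j\<in>S. \<Sum>i\<in>T. if i = m - j then ?d (P j k) *v v (m - j) else 0)"
    by (simp add: sum.cartesian_product split_def) (intro sum.cong, auto)
  also have "\<dots> = (\<Sum>j\<in>S. ?d (P j k) *v v (m - j))"
    using T by (intro sum.cong) auto
  finally show ?thesis by simp
qed

text \<open>
  The equations of the two lowest degrees. The first says that the leading term annihilates \<open>v d\<close>; the
  second exhibits its value on \<open>v e\<close> as a tangent vector, produced by another component of the same \<open>k\<close>.
\<close>

lemma lead_in_normal_stabilizer:
  assumes T: "finite T" "\<And>i. i \<notin> T \<Longrightarrow> v i = 0"
    and y: "\<And>t. t \<noteq> 0 \<Longrightarrow> \<rho> (l t) *v y = (\<Sum>i\<in>T. (t powi i) *s v i)"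
    and gap: "d < e" "\<And>i. i < e \<Longrightarrow> i \<noteq> d \<Longrightarrow> v i = 0"
    and k: "k \<in> lie_stabilizer G \<rho> y" "k \<noteq> 0"
  shows "lead k \<in> normal_stabilizer G \<rho> (v d) (v e)"
proof -
  let ?d = "differential G \<rho>"
  obtain a where a: "lead k = P a k" "P a k \<noteq> 0" "\<And>i. i < a \<Longrightarrow> P i k = 0" "a \<in> S"
    by (rule leadE[OF k(2)]) (rule that)
  have comp: "P j k \<in> lie_algebra_of G" for j
    using k(1) by (simp add: lie_stabilizer_def component_in_lie_algebra)
  \<comment> \<open>Degree \<open>a + d\<close>: components of \<open>k\<close> start at \<open>a\<close> and those of \<open>y\<close> at \<open>d\<close>, so one term is left.\<close>
  have "0 = (\<Sum>j\<in>S. ?d (P j k) *v v (a + d - j))"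
    using weighted_stabilizer_equation[OF T y k(1)] by simp
  also have "\<dots> = (\<Sum>j\<in>S. if j = a then ?d (P a k) *v v d else 0)"
  proof (intro sum.cong refl)
    fix j
    show "?d (P j k) *v v (a + d - j) = (if j = a then ?d (P a k) *v v d else 0)"
      using a(3)[of j] gap(1) gap(2)[of "a + d - j"]
      by (cases j a rule: linorder_cases) (auto simp: differential_zero)
  qed
  also have "\<dots> = ?d (P a k) *v v d" using a(4) by (simp add: finite_degrees)
  finally have stab: "?d (P a k) *v v d = 0" by simp
  let ?b = "a + e - d"
  \<comment> \<open>Degree \<open>a + e\<close>: since \<open>y\<close> has no components strictly between \<open>d\<close> and \<open>e\<close>, only \<open>j = a\<close> and \<open>j = a + e - d\<close> remain.\<close>
  have "0 = (\<Sum>j\<in>S. ?d (P j k) *v v (a + e - j))"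
    using weighted_stabilizer_equation[OF T y k(1)] by simp
  also have "\<dots> = (\<Sum>j\<in>S. (if j = a then ?d (P a k) *v v e else 0)
      + (if j = ?b then ?d (P ?b k) *v v d else 0))"
  proof (intro sum.cong refl)
    fix j
    show "?d (P j k) *v v (a + e - j) = (if j = a then ?d (P a k) *v v e else 0)
        + (if j = ?b then ?d (P ?b k) *v v d else 0)"
      using a(3)[of j] gap(1) gap(2)[of "a + e - j"]
      by (cases j a rule: linorder_cases) (auto simp: differential_zero)
  qed
  also have "\<dots> = ?d (P a k) *v v e + ?d (P ?b k) *v v d"
    using a(4) component_outside[of ?b k]
    by (simp add: sum.distrib finite_degrees differential_zero)
  finally have "?d (P a k) *v v e = - (?d (P ?b k) *v v d)"
    by (simp add: eq_neg_iff_add_eq_0)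
  also have "\<dots> = ?d (mscale (-1) (P ?b k)) *v v d"
    by (simp only: differential_scale[OF comp] mscale_mult_vector) (simp add: vec_eq_iff)
  finally have "?d (P a k) *v v e \<in> orbit_tangent_space G \<rho> (v d)"
    using comp mat_vs.subspace_scale[OF subspace_lie_algebra_of] unfolding orbit_tangent_space_def by blast
  then show ?thesis
    using stab comp by (simp add: normal_stabilizer_def lie_stabilizer_def a(1))
qed

lemma leading_space_eq_span_lead:
  assumes "K \<subseteq> lie_algebra_of G"
  shows "leading_space G l K = mat_vs.span (lead ` (K - {0}))"
proof -
  have "leading_term (lie_weight_space G l) ` (K - {0}) = lead ` (K - {0})"
    using assms by (intro image_cong refl leading_term_lie) auto
  then show ?thesis by (simp add: leading_space_def)
qed

text \<open>
  By bilinearity it suffices to bracket two leading terms, where \<open>lead_bracket\<close> applies.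
\<close>

lemma bracket_in_leading_span:
  assumes K: "\<And>A B. A \<in> K \<Longrightarrow> B \<in> K \<Longrightarrow> lie_bracket A B \<in> K"
    and AB: "A \<in> span (lead ` (K - {0}))" "B \<in> span (lead ` (K - {0}))"
  shows "lie_bracket A B \<in> span (lead ` (K - {0}))"
proof -
  let ?L = "lead ` (K - {0})"
  have gen: "lie_bracket (lead A) (lead B) \<in> span ?L" if A: "A \<in> K - {0}" and B: "B \<in> K - {0}" for A B
  proof (cases "lie_bracket (lead A) (lead B) = 0")
    case True
    then show ?thesis by (simp add: span_zero)
  next
    case False
    obtain a where a: "lead A = P a A" "P a A \<noteq> 0" "\<And>i. i < a \<Longrightarrow> P i A = 0" "a \<in> S"
      using A by (auto elim: leadE)
    obtain b where b: "lead B = P b B" "P b B \<noteq> 0" "\<And>i. i < b \<Longrightarrow> P i B = 0" "b \<in> S"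
      using B by (auto elim: leadE)
    have lead: "lead (lie_bracket A B) = lie_bracket (lead A) (lead B)"
      by (rule lead_bracket[OF a(1,3,4) b(1,3,4) False])
    have "lie_bracket A B \<noteq> 0" using False lead by (auto simp: lead_def component_zero)
    then have "lie_bracket A B \<in> K - {0}" using K A B by simp
    then show ?thesis unfolding lead[symmetric] by (intro span_base imageI)
  qed
  have bilinear: "lie_bracket (X + Y) Z = lie_bracket X Z + lie_bracket Y Z"
    "lie_bracket Z (X + Y) = lie_bracket Z X + lie_bracket Z Y"
    "lie_bracket (mscale c X) Z = mscale c (lie_bracket X Z)"
    "lie_bracket Z (mscale c X) = mscale c (lie_bracket Z X)"
    "lie_bracket 0 Z = 0" "lie_bracket Z 0 = 0" for X Y Z :: "complex^'n^'n" and c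
    by (simp_all add: lie_bracket_def matrix_add_ldistrib matrix_mult_add_left mscale_mult_left
        mscale_mult_right mat_vs.scale_right_diff_distrib)
  have right: "lie_bracket X B \<in> span ?L" if X: "X \<in> ?L" for X
    using AB(2)
  proof (induction rule: span_induct_alt)
    case (step c Y Z)
    then show ?case using gen X by (auto simp: bilinear intro!: span_add span_scale)
  qed (simp add: bilinear span_zero)
  show ?thesis
    using AB(1)
  proof (induction rule: span_induct_alt)
    case (step c Y Z)
    then show ?case using right by (auto simp: bilinear intro!: span_add span_scale)
  qed (simp add: bilinear span_zero)
qed

end

theorem theorem1p1:
  fixes G :: "(complex^'n^'n) set"
    and \<rho> :: "complex^'n^'n \<Rightarrow> complex^'m^'m"
    and c :: int
    and l :: "complex \<Rightarrow> complex^'n^'n"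
    and y z y\<^sub>e :: "complex^'m"
    and d e D :: int
    and w :: "int \<Rightarrow> complex^'m"
  assumes "reductive G"
    and "\<forall>t. t \<noteq> 0 \<longrightarrow> mat t \<in> G"
    and "rational_representation G \<rho>"
    and "c \<noteq> 0"
    and "\<forall>t v. t \<noteq> 0 \<longrightarrow> \<rho> (mat t) *v v = (t powi c) *s v"
    and "one_parameter_subgroup G l"
    and "d < e" and "e \<le> D" and "z \<noteq> 0" and "y\<^sub>e \<noteq> 0"
    and "\<forall>t. t \<noteq> 0 \<longrightarrow>
           \<rho> (l t) *v y = (t powi d) *s z + (t powi e) *s y\<^sub>e + (\<Sum>i\<in>{e<..D}. (t powi i) *s w i)"
  shows "lie_subalgebra (leading_space G l (lie_stabilizer G \<rho> y)) (lie_stabilizer G \<rho> z)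
       \<and> mat_vs.dim (leading_space G l (lie_stabilizer G \<rho> y)) = mat_vs.dim (lie_stabilizer G \<rho> y)
       \<and> leading_space G l (lie_stabilizer G \<rho> y) \<subseteq> normal_stabilizer G \<rho> z y\<^sub>e"
proof -
  have G: "subgroup G GL" using assms(1) by (simp add: reductive_def algebraic_group_def)
  obtain S P where "adjoint_grading S P G l"
    by (rule adjoint_grading_exists[OF G assms(6)]) (rule that)
  then interpret graded_representation S P G l \<rho>
    using G assms(3) by (simp add: graded_representation_def rational_linear_representation_def)
  let ?K = "lie_stabilizer G \<rho> y"
  have K: "?K \<subseteq> lie_algebra_of G" by (auto simp: lie_stabilizer_def)
  \<comment> \<open>The coefficients of \<open>\<rho> (l t) *v y\<close>, extended by zero to all integer exponents.\<close>
  define v where "v i = (if i = d then z else if i = e then y\<^sub>e else if e < i \<and> i \<le> D then w i else 0)" for i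
  have v: "v d = z" "v e = y\<^sub>e" using assms(7) by (simp_all add: v_def)
  have y: "\<rho> (l t) *v y = (\<Sum>i\<in>{d, e} \<union> {e<..D}. (t powi i) *s v i)" if "t \<noteq> 0" for t
  proof -
    have "(\<Sum>i\<in>{e<..D}. (t powi i) *s v i) = (\<Sum>i\<in>{e<..D}. (t powi i) *s w i)"
      using assms(7) by (intro sum.cong) (auto simp: v_def)
    moreover have "(\<Sum>i\<in>{d, e} \<union> {e<..D}. (t powi i) *s v i) =
        (\<Sum>i\<in>{d, e}. (t powi i) *s v i) + (\<Sum>i\<in>{e<..D}. (t powi i) *s v i)"
      using assms(7) by (intro sum.union_disjoint) auto
    ultimately show ?thesis using assms(7,11) that v by simp
  qed
  have outside: "v i = 0" if "i \<notin> {d, e} \<union> {e<..D}" for i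
    using that by (auto simp: v_def)
  have gap: "v i = 0" if "i < e" "i \<noteq> d" for i
    using that by (simp add: v_def)
  have lead: "lead k \<in> normal_stabilizer G \<rho> z y\<^sub>e" if "k \<in> ?K - {0}" for k
    using lead_in_normal_stabilizer[OF _ outside y assms(7) gap, of k] that by (simp add: v)
  have eq: "leading_space G l ?K = mat_vs.span (lead ` (?K - {0}))"
    by (rule leading_space_eq_span_lead[OF K])
  have normal: "leading_space G l ?K \<subseteq> normal_stabilizer G \<rho> z y\<^sub>e"
    unfolding eq using lead by (intro mat_vs.span_minimal subspace_normal_stabilizer) auto
  then have "leading_space G l ?K \<subseteq> lie_stabilizer G \<rho> z" by (auto simp: normal_stabilizer_def)
  moreover have "matrix_lie_algebra (leading_space G l ?K)"
    unfolding eq matrix_lie_algebra_def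
    using bracket_in_leading_span[OF bracket_in_lie_stabilizer] by (simp add: mat_vs.subspace_span)
  moreover have "mat_vs.dim (leading_space G l ?K) = mat_vs.dim ?K"
    unfolding eq by (rule dim_leading_span[OF subspace_lie_stabilizer])
  ultimately show ?thesis
    using normal by (simp add: lie_subalgebra_def matrix_lie_algebra_lie_stabilizer)
qed

end
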